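(* Let $\mathfrak{P}_{\mathrm{sg}}=\mathfrak{P}_{\mathrm{sg}}(M,\sigma,\bar K)$ with $M,\sigma,\bar K>0$ fixed. The boundary $\mathcal R_T\cdot\mathcal S_T=\Theta(T^{3/2})$ forms the Pareto frontier (up to polylogarithmic factors in $T$) between worst-case regret $\mathcal R_T$ and worst-case allocation variability $\mathcal S_T$ for active-learning algorithms.
   Context: Stochastic multi-armed bandit. There are $K$ arms; for each arm $i\in[K]=\{1,\dots,K\}$, $(X^i_s)_{s\ge1}$ is an i.i.d. reward sequence with law $\nu_i$, independent across arms; $\nu=(\nu_1,\dots,\nu_K)$ is the (unknown) bandit instance. For a horizon $T$, an algorithm selects at each time $t\in[T]$ an arm $A_t\sim\pi_t(\cdot\mid\mathcal H_{t-1})$, where $\mathcal H_{t-1}=(A_1,r_1,\dots,A_{t-1},r_{t-1})$ is the observed history, $\pi_t(\cdot\mid \mathcal H_{t-1})$ is a distribution on $[K]$, $N_{i,t}=\sum_{s=1}^t\mathbf 1\{A_s=i\}$, and $r_t=X^{A_t}_{N_{A_t,t}}$. Let $\mu_i$ be the mean of $\nu_i$, $\Delta_i=\max_j\mu_j-\mu_i$. Regret: $R_T(\nu)=\sum_{i=1}^K\Delta_i\,\mathbb E[N_{i,T}]$. Allocation variability: $S_T(\nu)=\max_{i\in[K]}\sqrt{\operatorname{Var}(N_{i,T})}$. $\mathfrak{P}_{\mathrm{sg}}(M,\sigma,\bar K)$ is the class of instances $\nu=(\nu_1,\dots,\nu_K)$ with $2\le K\le\bar K$ such that each $\nu_i$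 has mean $\mu_i\in[-M,M]$ and is $\sigma$-sub-Gaussian. $\mathcal R_T=\sup_{\nu\in\mathfrak{P}_{\mathrm{sg}}}R_T(\nu)$, $\mathcal S_T=\sup_{\nu\in\mathfrak{P}_{\mathrm{sg}}}S_T(\nu)$. Standing assumptions on algorithms: (i) if $\nu_i=\nu_j$ for some $i\ne j$ then $\mathbb E[N_{i,T}]=\mathbb E[N_{j,T}]$; (ii) for $T\ge K$, $\mathbb E[N_{i,T}]\ge1$ for each arm $i$. An algorithm is active-learning if $\lim_{T\to\infty}\mathcal R_T/T=0$. "Pareto frontier" refers to the $(\mathcal R_T,\mathcal S_T)$ plane, both quantities to be made small: the performance of every active-learning algorithm lies in the region $\mathcal R_T\cdot\mathcal S_T=\Omega(T^{3/2})$, and every point $(\mathcal R_T,\mathcal S_T)$ on the curve $\mathcal R_T\cdot\mathcal S_T=\Theta(T^{3/2})$ is achievable up to factors polylogarithmic in $T$. *)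

theory Defs
  imports "HOL-Probability.Probability" "HOL-Library.Landau_Symbols"
begin

text \<open>
  An instance with \<open>K\<close> arms is the list of its \<open>K\<close> reward laws, so arms are numbered
  \<open>0, \<dots>, K - 1\<close>. A policy maps the history, i.e. the chronological list of
  (action, reward) pairs, to the distribution of the next action; the time index is the
  length of the history. An algorithm chooses a policy for each horizon \<open>T\<close> and each
  number of arms \<open>K\<close>.
\<close>

type_synonym bandit = "real measure list"
type_synonym policy = "(nat \<times> real) list \<Rightarrow> nat pmf"
type_synonym algorithm = "nat \<Rightarrow> nat \<Rightarrow> policy"

text \<open>
  For every fixed sequence of past actions, the probability of the next action has to be a
  Borel function of the past rewards, i.e. the policy is a Markov kernel.
\<close>

definition is_policy :: "nat \<Rightarrow> policy \<Rightarrow> bool" where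
  "is_policy K \<pi> \<longleftrightarrow>
     (\<forall>h. set_pmf (\<pi> h) \<subseteq> {..<K}) \<and>
     (\<forall>as a. set as \<subseteq> {..<K} \<longrightarrow>
        (\<lambda>r. pmf (\<pi> (zip as (map r [0..<length as]))) a)
          \<in> borel_measurable (\<Pi>\<^sub>M t\<in>{..<length as}. (borel :: real measure)))"

definition is_algorithm :: "algorithm \<Rightarrow> bool" where
  "is_algorithm alg \<longleftrightarrow> (\<forall>T. \<forall>K\<ge>1. is_policy K (alg T K))"

text \<open>
  The table \<open>x (i, s)\<close>, \<open>s \<ge> 1\<close>, holds the reward of the \<open>s\<close>-th pull of arm \<open>i\<close>.
\<close>

definition reward_table :: "bandit \<Rightarrow> (nat \<times> nat \<Rightarrow> real) measure" where
  "reward_table \<nu> = (\<Pi>\<^sub>M p\<in>{..<length \<nu>} \<times> {1..}. \<nu> ! fst p)"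

definition history :: "(nat \<times> nat \<Rightarrow> real) \<Rightarrow> nat list \<Rightarrow> (nat \<times> real) list" where
  "history x as =
     map (\<lambda>t. (as ! t, x (as ! t, count_list (take (Suc t) as) (as ! t)))) [0..<length as]"

text \<open>The conditional law of the first \<open>t\<close> actions given the reward table \<open>x\<close>.\<close>

primrec actions :: "policy \<Rightarrow> (nat \<times> nat \<Rightarrow> real) \<Rightarrow> nat \<Rightarrow> nat list pmf" where
  "actions \<pi> x 0 = return_pmf []"
| "actions \<pi> x (Suc t) =
     bind_pmf (actions \<pi> x t) (\<lambda>as. map_pmf (\<lambda>a. as @ [a]) (\<pi> (history x as)))"

definition action_law :: "policy \<Rightarrow> bandit \<Rightarrow> nat \<Rightarrow> nat list measure" where
  "action_law \<pi> \<nu> T = bind (reward_table \<nu>) (\<lambda>x. measure_pmf (actions \<pi> x T))"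

definition expected_pulls :: "policy \<Rightarrow> bandit \<Rightarrow> nat \<Rightarrow> nat \<Rightarrow> real" where
  "expected_pulls \<pi> \<nu> T i = (\<integral>as. real (count_list as i) \<partial>action_law \<pi> \<nu> T)"

definition variance_pulls :: "policy \<Rightarrow> bandit \<Rightarrow> nat \<Rightarrow> nat \<Rightarrow> real" where
  "variance_pulls \<pi> \<nu> T i =
     (\<integral>as. (real (count_list as i) - expected_pulls \<pi> \<nu> T i)\<^sup>2 \<partial>action_law \<pi> \<nu> T)"

definition mean :: "real measure \<Rightarrow> real" where
  "mean N = (\<integral>x. x \<partial>N)"

definition sub_gaussian :: "real \<Rightarrow> real measure \<Rightarrow> bool" where
  "sub_gaussian \<sigma> N \<longleftrightarrow>
     (\<forall>l. integrable N (\<lambda>x. exp (l * (x - mean N))) \<and>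
          (\<integral>x. exp (l * (x - mean N)) \<partial>N) \<le> exp (l\<^sup>2 * \<sigma>\<^sup>2 / 2))"

definition gap :: "bandit \<Rightarrow> nat \<Rightarrow> real" where
  "gap \<nu> i = Max ((\<lambda>j. mean (\<nu> ! j)) ` {..<length \<nu>}) - mean (\<nu> ! i)"

definition regret :: "algorithm \<Rightarrow> bandit \<Rightarrow> nat \<Rightarrow> real" where
  "regret alg \<nu> T = (\<Sum>i<length \<nu>. gap \<nu> i * expected_pulls (alg T (length \<nu>)) \<nu> T i)"

definition variability :: "algorithm \<Rightarrow> bandit \<Rightarrow> nat \<Rightarrow> real" where
  "variability alg \<nu> T =
     Max ((\<lambda>i. sqrt (variance_pulls (alg T (length \<nu>)) \<nu> T i)) ` {..<length \<nu>})"

definition sg_class :: "real \<Rightarrow> real \<Rightarrow> nat \<Rightarrow> bandit set" where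
  "sg_class M \<sigma> Kbar =
     {\<nu>. 2 \<le> length \<nu> \<and> length \<nu> \<le> Kbar \<and>
         (\<forall>N\<in>set \<nu>. prob_space N \<and> sets N = sets borel \<and> integrable N (\<lambda>x. x) \<and>
                    mean N \<in> {-M..M} \<and> sub_gaussian \<sigma> N)}"

text \<open>
  On \<open>sg_class M \<sigma> Kbar\<close> the regret is at most \<open>2 M T\<close> and the variability at most \<open>T\<close>, so
  for \<open>Kbar \<ge> 2\<close> the suprema below are over nonempty bounded sets.
\<close>

definition worst_regret :: "real \<Rightarrow> real \<Rightarrow> nat \<Rightarrow> algorithm \<Rightarrow> nat \<Rightarrow> real" where
  "worst_regret M \<sigma> Kbar alg T = (SUP \<nu>\<in>sg_class M \<sigma> Kbar. regret alg \<nu> T)"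

definition worst_variability :: "real \<Rightarrow> real \<Rightarrow> nat \<Rightarrow> algorithm \<Rightarrow> nat \<Rightarrow> real" where
  "worst_variability M \<sigma> Kbar alg T = (SUP \<nu>\<in>sg_class M \<sigma> Kbar. variability alg \<nu> T)"

definition standing_assumptions :: "real \<Rightarrow> real \<Rightarrow> nat \<Rightarrow> algorithm \<Rightarrow> bool" where
  "standing_assumptions M \<sigma> Kbar alg \<longleftrightarrow>
     (\<forall>\<nu>\<in>sg_class M \<sigma> Kbar. \<forall>T. \<forall>i<length \<nu>.
        (\<forall>j<length \<nu>. \<nu> ! i = \<nu> ! j \<longrightarrow>
           expected_pulls (alg T (length \<nu>)) \<nu> T i = expected_pulls (alg T (length \<nu>)) \<nu> T j) \<and>
        (length \<nu> \<le> T \<longrightarrow> 1 \<le> expected_pulls (alg T (length \<nu>)) \<nu> T i))"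

definition active_learning :: "real \<Rightarrow> real \<Rightarrow> nat \<Rightarrow> algorithm \<Rightarrow> bool" where
  "active_learning M \<sigma> Kbar alg \<longleftrightarrow>
     is_algorithm alg \<and> standing_assumptions M \<sigma> Kbar alg \<and>
     (\<lambda>T. worst_regret M \<sigma> Kbar alg T / real T) \<longlonglongrightarrow> 0"

end

theory Submission
  imports Defs "HOL-Real_Asymp.Real_Asymp"
begin

text \<open>
  Lower bound. Consider two arms with rewards \<open>\<plusminus>\<sigma>\<close>. If they have the same law, the first arm has
  \<open>T / 2\<close> expected pulls; if the second one is better by \<open>4 R / T\<close>, where \<open>R\<close> is the worst-case
  regret, the first arm has at most \<open>T / 4\<close>. The expected number of pulls changes with the
  parameter at a rate of at most the standard deviation of the pulls times the root of the Fisher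
  information, which is of order \<open>T\<close> for the whole reward table. Hence
  \<open>T / 4 \<le> const * S * sqrt T * (R / T)\<close>.

  Upper bound. Run UCB with the bonus \<open>b / sqrt n\<close>, where \<open>b\<close> is about \<open>r / sqrt T\<close>. At the last pull
  of an arm its index dominates the others; this gives a regret of order \<open>b * sqrt T\<close>. When two
  runs on concentrated tables are compared, the means cancel from these inequalities and the pull
  counts of the runs differ by at most order \<open>\<beta> * T / b\<close>, where \<open>\<beta> / sqrt n\<close> with
  \<open>\<beta> = 3 * \<sigma> * ln T\<close> is the width of the confidence intervals.

  The remaining two inequalities at a point of the frontier follow from the lower bound.
\<close>

subsection \<open>Runs of a policy\<close>

text \<open>The bonus parameter moves along the frontier: for UCB the regret
  \<open>b * sqrt T\<close> and the variability \<open>\<beta> * T / b\<close> have a product free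
  of \<open>b\<close>.

  The obstacle in the lower bound is that a shift of order \<open>R / T\<close> may far exceed
  \<open>1 / sqrt T\<close>, and then the chi-square divergence between the two tables grows
  exponentially. So the mean is moved through many nearby instances. The variance is needed at each
  of them, which is where the worst case over the class enters. The equal treatment of equal arms
  supplies \<open>T / 2\<close>; the guaranteed pull of every arm makes \<open>R\<close> positive.

  In the upper bound no formula for the typical pull counts is at hand. Comparing two runs avoids
  one: the second moment is taken about the counts of a single good run. Rewards are indexed by pull
  number, so good tables can be singled out before any policy acts, and on them the argument is
  deterministic.\<close>

definition pull_lists :: "nat \<Rightarrow> nat \<Rightarrow> nat list set" where
  "pull_lists K t = {as. set as \<subseteq> {..<K} \<and> length as = t}"

lemma finite_pull_lists [simp]: "finite (pull_lists K t)"
  unfolding pull_lists_def by (rule finite_lists_length_eq) simp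

lemma sum_count_list_pull_lists:
  assumes "as \<in> pull_lists K t"
  shows "(\<Sum>i<K. count_list as i) = t"
proof -
  have "(\<Sum>i<K. count_list as i) = (\<Sum>i\<in>set as. count_list as i)"
    using assms by (intro sum.mono_neutral_right) (auto simp: pull_lists_def count_list_0_iff)
  thus ?thesis using assms by (simp add: pull_lists_def sum_count_set)
qed

lemma count_list_le_horizon: "as \<in> pull_lists K t \<Longrightarrow> count_list as i \<le> t"
  using count_le_length[of as i] by (simp add: pull_lists_def)

lemma history_cong:
  assumes "\<And>i s. i \<in> set as \<Longrightarrow> 1 \<le> s \<Longrightarrow> s \<le> length as \<Longrightarrow> x (i, s) = y (i, s)"
  shows "history x as = history y as"
proof -
  have "x (as ! t, count_list (take (Suc t) as) (as ! t)) =
        y (as ! t, count_list (take (Suc t) as) (as ! t))" if "t < length as" for t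
  proof (rule assms)
    show "as ! t \<in> set as" using that by simp
    show "1 \<le> count_list (take (Suc t) as) (as ! t)"
      using that by (simp add: take_Suc_conv_app_nth)
    show "count_list (take (Suc t) as) (as ! t) \<le> length as"
      using count_le_length[of "take (Suc t) as" "as ! t"] by simp
  qed
  thus ?thesis unfolding history_def by (intro map_cong) auto
qed

text \<open>Turns statements about random runs into deterministic ones: each action of a possible
  run was admissible given the history before it.\<close>

lemma set_pmf_actions:
  assumes "as \<in> set_pmf (actions \<pi> x t)"
  shows "length as = t \<and> (\<forall>s<t. as ! s \<in> set_pmf (\<pi> (history x (take s as))))"
  using assms
proof (induction t arbitrary: as)
  case (Suc t)
  then obtain bs a where *: "bs \<in> set_pmf (actions \<pi> x t)" "a \<in> set_pmf (\<pi> (history x bs))"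
    "as = bs @ [a]" by auto
  show ?case using Suc.IH[OF *(1)] * by (auto simp: nth_append less_Suc_eq)
qed auto

lemma actions_subset_pull_lists:
  assumes "\<And>h. set_pmf (\<pi> h) \<subseteq> {..<K}"
  shows "set_pmf (actions \<pi> x t) \<subseteq> pull_lists K t"
proof
  fix as assume as: "as \<in> set_pmf (actions \<pi> x t)"
  have "a < K" if "a \<in> set as" for a
  proof -
    from that obtain s where "s < length as" "a = as ! s" by (auto simp: in_set_conv_nth)
    with set_pmf_actions[OF as] assms[of "history x (take s as)"] show ?thesis by auto
  qed
  with set_pmf_actions[OF as] show "as \<in> pull_lists K t" by (auto simp: pull_lists_def)
qed

text \<open>Only the prefix \<open>as\<close> extends to \<open>as @ [a]\<close>, so the mixture
  over prefixes collapses to one term. Measurability of run probabilities rests on this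
  recursion.\<close>

lemma pmf_actions_snoc:
  "pmf (actions \<pi> x (Suc t)) (as @ [a]) = pmf (actions \<pi> x t) as * pmf (\<pi> (history x as)) a"
proof -
  have "pmf (map_pmf (\<lambda>a. bs @ [a]) (\<pi> (history x bs))) (as @ [a]) =
        indicator {as} bs * pmf (\<pi> (history x as)) a" for bs
  proof (cases "bs = as")
    case True
    have "inj (\<lambda>a. as @ [a])" by (rule injI) simp
    from pmf_map_inj'[OF this] show ?thesis using True by simp
  next
    case False
    thus ?thesis by (auto simp: pmf_eq_0_set_pmf)
  qed
  thus ?thesis by (simp add: pmf_bind) (simp add: measure_pmf_single)
qed

text \<open>A run of length \<open>t\<close> reads at most \<open>t\<close> rewards of each arm.
  Hence only a finite block of the infinite table matters when the measure is changed.\<close>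

lemma actions_cong:
  assumes "\<And>h. set_pmf (\<pi> h) \<subseteq> {..<K}"
    and "\<And>i s. i < K \<Longrightarrow> 1 \<le> s \<Longrightarrow> s \<le> t \<Longrightarrow> x (i, s) = y (i, s)"
  shows "actions \<pi> x t = actions \<pi> y t"
  using assms(2)
proof (induction t)
  case (Suc t)
  have "actions \<pi> x t = actions \<pi> y t" by (rule Suc.IH) (auto intro: Suc.prems)
  moreover have "history x as = history y as" if "as \<in> set_pmf (actions \<pi> y t)" for as
  proof (rule history_cong)
    fix i s assume "i \<in> set as" "1 \<le> s" "s \<le> length as"
    moreover have "length as = t" "set as \<subseteq> {..<K}"
      using actions_subset_pull_lists[of \<pi> K y t] assms(1) that by (auto simp: pull_lists_def)
    ultimately show "x (i, s) = y (i, s)" by (intro Suc.prems) auto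
  qed
  ultimately show ?case by (auto intro!: bind_pmf_cong)
qed simp

section \<open>Measurability in the reward table and the law of the actions\<close>

locale bandit_run =
  fixes \<nu> :: bandit and \<pi> :: policy
  assumes policy: "is_policy (length \<nu>) \<pi>"
    and prob_laws: "\<And>i. i < length \<nu> \<Longrightarrow> prob_space (\<nu> ! i)"
    and sets_laws: "\<And>i. i < length \<nu> \<Longrightarrow> sets (\<nu> ! i) = sets borel"
begin

abbreviation "K \<equiv> length \<nu>"

lemma set_pmf_policy: "set_pmf (\<pi> h) \<subseteq> {..<K}"
  using policy unfolding is_policy_def by blast

sublocale P: prob_space "reward_table \<nu>"
  unfolding reward_table_def by (rule prob_space_PiM) (auto intro: prob_laws)

lemma sets_reward_table [measurable_cong]:
  "sets (reward_table \<nu>) = sets (PiM ({..<K} \<times> {1..}) (\<lambda>_. borel :: real measure))"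
  unfolding reward_table_def by (rule sets_PiM_cong) (auto simp: sets_laws)

lemma measurable_table_component:
  "i < K \<Longrightarrow> 1 \<le> s \<Longrightarrow> (\<lambda>x. x (i, s)) \<in> borel_measurable (reward_table \<nu>)"
  by (subst measurable_cong_sets[OF sets_reward_table refl]) (rule measurable_component_singleton, auto)

lemma actions_in_pull_lists: "set_pmf (actions \<pi> x t) \<subseteq> pull_lists K t"
  using set_pmf_policy by (rule actions_subset_pull_lists)

text \<open>There are finitely many runs of a given length, so questions of measurability reduce to
  the probabilities of single runs.\<close>

lemma integral_actions:
  "(\<integral>as. F as \<partial>actions \<pi> x t) = (\<Sum>as\<in>pull_lists K t. F as * pmf (actions \<pi> x t) as)"
  for F :: "nat list \<Rightarrow> real"
  using actions_in_pull_lists by (intro integral_measure_pmf_real) auto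

text \<open>\<open>is_policy\<close> speaks of rewards listed by time. For fixed actions each of
  them sits at a fixed position (arm, pull number) of the table, and \<open>R\<close> reads them
  off.\<close>

lemma measurable_policy_history:
  assumes "set as \<subseteq> {..<K}"
  shows "(\<lambda>x. pmf (\<pi> (history x as)) a) \<in> borel_measurable (reward_table \<nu>)"
proof -
  define n where "n = (\<lambda>t. count_list (take (Suc t) as) (as ! t))"
  define R where "R = (\<lambda>x :: nat \<times> nat \<Rightarrow> real. \<lambda>t\<in>{..<length as}. x (as ! t, n t))"
  have n: "1 \<le> n t" if "t < length as" for t
    using that by (simp add: n_def take_Suc_conv_app_nth)
  have R: "R \<in> measurable (reward_table \<nu>) (\<Pi>\<^sub>M t\<in>{..<length as}. (borel :: real measure))"
    unfolding R_def
  proof (rule measurable_restrict)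
    fix t assume "t \<in> {..<length as}"
    moreover have "as ! t < K" if "t < length as" using assms nth_mem[OF that] by blast
    ultimately show "(\<lambda>x. x (as ! t, n t)) \<in> borel_measurable (reward_table \<nu>)"
      using n by (intro measurable_table_component) auto
  qed
  have "history x as = zip as (map (R x) [0..<length as])" for x
    by (rule nth_equalityI) (auto simp: history_def R_def n_def)
  moreover have "(\<lambda>r. pmf (\<pi> (zip as (map r [0..<length as]))) a)
          \<in> borel_measurable (\<Pi>\<^sub>M t\<in>{..<length as}. (borel :: real measure))"
    using policy assms unfolding is_policy_def by blast
  ultimately show ?thesis using measurable_compose[OF R] by simp
qed

lemma measurable_pmf_actions:
  "(\<lambda>x. pmf (actions \<pi> x t) as) \<in> borel_measurable (reward_table \<nu>)"
proof (induction t arbitrary: as)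
  case (Suc t)
  show ?case
  proof (cases "as \<in> pull_lists K (Suc t)")
    case False
    hence "pmf (actions \<pi> x (Suc t)) as = 0" for x
      using actions_in_pull_lists by (metis pmf_eq_0_set_pmf subsetD)
    thus ?thesis by simp
  next
    case True
    hence "as \<noteq> []" by (auto simp: pull_lists_def)
    then obtain bs a where as: "as = bs @ [a]" by (metis rev_exhaust)
    show ?thesis unfolding as pmf_actions_snoc
      using True by (intro borel_measurable_times Suc.IH measurable_policy_history) 
        (auto simp: as pull_lists_def)
  qed
qed simp

lemma measurable_integral_actions:
  "(\<lambda>x. \<integral>as. F as \<partial>actions \<pi> x t) \<in> borel_measurable (reward_table \<nu>)"
  for F :: "nat list \<Rightarrow> real"
  unfolding integral_actions by (intro borel_measurable_sum borel_measurable_times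
      borel_measurable_const measurable_pmf_actions)

lemma measurable_actions:
  "(\<lambda>x. measure_pmf (actions \<pi> x t)) \<in> measurable (reward_table \<nu>) (subprob_algebra (count_space UNIV))"
proof (rule measurable_subprob_algebra)
  fix A :: "nat list set"
  have "emeasure (measure_pmf (actions \<pi> x t)) A = ennreal (\<integral>as. indicator A as \<partial>actions \<pi> x t)" for x
    by (simp add: measure_pmf.emeasure_eq_measure)
  thus "(\<lambda>x. emeasure (measure_pmf (actions \<pi> x t)) A) \<in> borel_measurable (reward_table \<nu>)"
    using measurable_integral_actions[of t "indicator A"] by simp
qed (auto intro: prob_space_imp_subprob_space measure_pmf.prob_space_axioms)

text \<open>\<open>integral_bind\<close> asks for a bounded integrand. \<open>F\<close> is
  arbitrary, so it is truncated to \<open>G\<close> on the finite set of possible runs, where almost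
  every run lies.\<close>

lemma integral_action_law:
  "(\<integral>as. F as \<partial>action_law \<pi> \<nu> t) = (\<integral>x. (\<integral>as. F as \<partial>actions \<pi> x t) \<partial>reward_table \<nu>)"
  for F :: "nat list \<Rightarrow> real"
proof -
  define G where "G = (\<lambda>as. F as * indicator (pull_lists K t) as)"
  have [measurable_cong, simp]: "sets (action_law \<pi> \<nu> t) = sets (count_space UNIV)"
    unfolding action_law_def by (rule sets_bind) (auto simp: P.not_empty)
  have "(AE as in action_law \<pi> \<nu> t. as \<in> pull_lists K t)"
    unfolding action_law_def
    by (subst AE_bind[OF measurable_actions]) 
      (use actions_in_pull_lists in \<open>auto simp: AE_measure_pmf_iff\<close>)
  hence "(\<integral>as. F as \<partial>action_law \<pi> \<nu> t) = (\<integral>as. G as \<partial>action_law \<pi> \<nu> t)"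
    by (intro integral_cong_AE) (auto simp: G_def measurable_cong_sets[of "action_law \<pi> \<nu> t"])
  also have "\<dots> = (\<integral>x. (\<integral>as. G as \<partial>actions \<pi> x t) \<partial>reward_table \<nu>)"
    unfolding action_law_def
  proof (rule integral_bind[OF _ _ measurable_actions P.finite_measure])
    fix as
    show "\<bar>G as\<bar> \<le> (\<Sum>bs\<in>pull_lists K t. \<bar>F bs\<bar>)"
      using member_le_sum[of as "pull_lists K t" "\<lambda>bs. \<bar>F bs\<bar>"]
      by (auto simp: G_def indicator_def intro: sum_nonneg)
    show "AE x in reward_table \<nu>. emeasure (measure_pmf (actions \<pi> x t))
             (space (measure_pmf (actions \<pi> x t))) \<le> ennreal 1"
      using measure_pmf.emeasure_space_1 by simp
  qed auto
  also have "\<dots> = (\<integral>x. (\<integral>as. F as \<partial>actions \<pi> x t) \<partial>reward_table \<nu>)"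
    by (simp add: integral_actions G_def cong: sum.cong)
  finally show ?thesis .
qed

lemma integral_actions_bounds:
  assumes "\<And>as. as \<in> set_pmf (actions \<pi> x t) \<Longrightarrow> a \<le> F as \<and> F as \<le> b"
  shows "a \<le> (\<integral>as. F as \<partial>actions \<pi> x t)" "(\<integral>as. F as \<partial>actions \<pi> x t) \<le> (b :: real)"
proof -
  have "finite (set_pmf (actions \<pi> x t))"
    using finite_subset[OF actions_in_pull_lists] by simp
  hence "integrable (actions \<pi> x t) F" by (rule integrable_measure_pmf_finite)
  thus "a \<le> (\<integral>as. F as \<partial>actions \<pi> x t)" "(\<integral>as. F as \<partial>actions \<pi> x t) \<le> b"
    using assms by (auto intro!: measure_pmf.integral_ge_const measure_pmf.integral_le_const
        simp: AE_measure_pmf_iff)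
qed

lemma integrable_integral_actions:
  "integrable (reward_table \<nu>) (\<lambda>x. \<integral>as. F as \<partial>actions \<pi> x t)"
  for F :: "nat list \<Rightarrow> real"
proof (rule P.integrable_const_bound)
  define B where "B = (\<Sum>bs\<in>pull_lists K t. \<bar>F bs\<bar>)"
  have B: "- B \<le> F as \<and> F as \<le> B" if "as \<in> set_pmf (actions \<pi> x t)" for x as
    using member_le_sum[of as "pull_lists K t" "\<lambda>bs. \<bar>F bs\<bar>"] that actions_in_pull_lists[of x t]
    by (auto simp: B_def)
  show "AE x in reward_table \<nu>. norm (\<integral>as. F as \<partial>actions \<pi> x t) \<le> B"
  proof (rule AE_I2)
    fix x
    show "norm (\<integral>as. F as \<partial>actions \<pi> x t) \<le> B"
      using integral_actions_bounds[of x t "- B" F B] B[of _ x] by (simp add: abs_le_iff)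
  qed
qed (rule measurable_integral_actions)

lemma expected_pulls_eq:
  "expected_pulls \<pi> \<nu> t i = (\<integral>x. (\<integral>as. real (count_list as i) \<partial>actions \<pi> x t) \<partial>reward_table \<nu>)"
  unfolding expected_pulls_def by (rule integral_action_law)

lemma variance_pulls_eq:
  "variance_pulls \<pi> \<nu> t i =
     (\<integral>x. (\<integral>as. (real (count_list as i) - expected_pulls \<pi> \<nu> t i)\<^sup>2 \<partial>actions \<pi> x t) \<partial>reward_table \<nu>)"
  unfolding variance_pulls_def by (rule integral_action_law)

lemma integral_action_law_bounds:
  assumes "\<And>x as. as \<in> pull_lists K t \<Longrightarrow> x \<in> space (reward_table \<nu>) \<Longrightarrow>
             as \<in> set_pmf (actions \<pi> x t) \<Longrightarrow> a \<le> F as \<and> F as \<le> b"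
  shows "a \<le> (\<integral>as. F as \<partial>action_law \<pi> \<nu> t)" "(\<integral>as. F as \<partial>action_law \<pi> \<nu> t) \<le> (b :: real)"
proof -
  have *: "a \<le> (\<integral>as. F as \<partial>actions \<pi> x t)" "(\<integral>as. F as \<partial>actions \<pi> x t) \<le> b"
    if "x \<in> space (reward_table \<nu>)" for x
    using integral_actions_bounds[of x t a F b] assms[OF _ that] actions_in_pull_lists[of x t]
    by (auto simp: subset_eq)
  show "a \<le> (\<integral>as. F as \<partial>action_law \<pi> \<nu> t)" unfolding integral_action_law
    by (rule P.integral_ge_const[OF integrable_integral_actions]) (use * in auto)
  show "(\<integral>as. F as \<partial>action_law \<pi> \<nu> t) \<le> b" unfolding integral_action_law
    by (rule P.integral_le_const[OF integrable_integral_actions]) (use * in auto)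
qed

lemma expected_pulls_bounds: "0 \<le> expected_pulls \<pi> \<nu> t i" "expected_pulls \<pi> \<nu> t i \<le> real t"
  unfolding expected_pulls_def
  by (rule integral_action_law_bounds[where b = "real t" and a = 0],
      use count_list_le_horizon in auto)+

lemma variance_pulls_bounds: "0 \<le> variance_pulls \<pi> \<nu> t i" "variance_pulls \<pi> \<nu> t i \<le> (real t)\<^sup>2"
proof -
  have "(real (count_list as i) - expected_pulls \<pi> \<nu> t i)\<^sup>2 \<le> (real t)\<^sup>2" 
    if "as \<in> pull_lists K t" for as
    using count_list_le_horizon[OF that, of i] expected_pulls_bounds[of t i]
    by (subst abs_le_square_iff[symmetric]) auto
  thus "0 \<le> variance_pulls \<pi> \<nu> t i" "variance_pulls \<pi> \<nu> t i \<le> (real t)\<^sup>2"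
    unfolding variance_pulls_def
    by (auto intro!: integral_action_law_bounds[where b = "(real t)\<^sup>2" and a = 0])
qed

lemma sum_expected_pulls: "(\<Sum>i<K. expected_pulls \<pi> \<nu> t i) = real t"
proof -
  have "(\<Sum>i<K. expected_pulls \<pi> \<nu> t i) =
        (\<integral>x. (\<Sum>i<K. \<integral>as. real (count_list as i) \<partial>actions \<pi> x t) \<partial>reward_table \<nu>)"
    unfolding expected_pulls_eq
    by (rule Bochner_Integration.integral_sum[symmetric]) (rule integrable_integral_actions)
  also have "\<dots> = (\<integral>x. real t \<partial>reward_table \<nu>)"
  proof (rule Bochner_Integration.integral_cong[OF refl])
    fix x
    have "(\<Sum>i<K. \<integral>as. real (count_list as i) \<partial>actions \<pi> x t) =
          (\<integral>as. (\<Sum>i<K. real (count_list as i)) \<partial>actions \<pi> x t)"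
      by (rule Bochner_Integration.integral_sum[symmetric], rule integrable_measure_pmf_finite)
        (use finite_subset[OF actions_in_pull_lists] in simp)
    also have "\<dots> = (\<integral>as. real t \<partial>actions \<pi> x t)"
      by (rule integral_cong_AE)
        (use actions_in_pull_lists[of x t] sum_count_list_pull_lists[of _ K t] in
          \<open>auto simp: AE_measure_pmf_iff simp flip: of_nat_sum\<close>)
    finally show "(\<Sum>i<K. \<integral>as. real (count_list as i) \<partial>actions \<pi> x t) = real t" by simp
  qed
  finally show ?thesis by (simp add: P.prob_space)
qed

end

subsection \<open>Change of measure\<close>

text \<open>The product involves only the coordinates in \<open>J\<close>. Restriction to
  \<open>J\<close> maps the possibly infinite product measure to a finite one, where Fubini gives
  the claim.\<close>

lemma (in product_prob_space)
  fixes f :: "'i \<Rightarrow> 'a \<Rightarrow> real"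
  assumes J: "finite J" "J \<subseteq> I" and int: "\<And>i. i \<in> J \<Longrightarrow> integrable (M i) (f i)"
  shows integral_prod_components:
      "(\<integral>x. (\<Prod>i\<in>J. f i (x i)) \<partial>PiM I M) = (\<Prod>i\<in>J. \<integral>x. f i x \<partial>M i)"
    and integrable_prod_components: "integrable (PiM I M) (\<lambda>x. \<Prod>i\<in>J. f i (x i))"
proof -
  have restr: "distr (PiM I M) (PiM J M) (\<lambda>x. restrict x J) = PiM J M"
    using J by (rule distr_PiM_restrict_finite)
  have [measurable]: "(\<lambda>x. restrict x J) \<in> measurable (PiM I M) (PiM J M)"
    using J by (intro measurable_restrict_subset)
  have int': "integrable (PiM J M) (\<lambda>x. \<Prod>i\<in>J. f i (x i))"
    using J int by (intro product_integrable_prod)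
  have "(\<integral>x. (\<Prod>i\<in>J. f i (x i)) \<partial>PiM J M) = (\<Prod>i\<in>J. \<integral>x. f i x \<partial>M i)"
    using J int by (intro product_integral_prod)
  moreover have "(\<integral>x. (\<Prod>i\<in>J. f i (x i)) \<partial>PiM J M) = (\<integral>x. (\<Prod>i\<in>J. f i (restrict x J i)) \<partial>PiM I M)"
    by (subst restr[symmetric], rule integral_distr) (use int' in auto)
  ultimately show "(\<integral>x. (\<Prod>i\<in>J. f i (x i)) \<partial>PiM I M) = (\<Prod>i\<in>J. \<integral>x. f i x \<partial>M i)"
    by simp
  have "integrable (PiM I M) (\<lambda>x. \<Prod>i\<in>J. f i (restrict x J i))"
    by (rule integrable_distr[of "\<lambda>x. restrict x J" "PiM I M" "PiM J M"]) (use int' restr in auto)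
  thus "integrable (PiM I M) (\<lambda>x. \<Prod>i\<in>J. f i (x i))" by simp
qed

text \<open>A product measure is determined by its values on boxes, and on a box both the density
  and the indicator factor over the coordinates.\<close>

lemma PiM_density:
  assumes "product_prob_space M" "product_prob_space M'" "finite J"
    and f: "\<And>i. i \<in> J \<Longrightarrow> f i \<in> borel_measurable (M i)"
    and dens: "\<And>i. i \<in> J \<Longrightarrow> M' i = density (M i) (f i)"
  shows "PiM J M' = density (PiM J M) (\<lambda>x. \<Prod>i\<in>J. f i (x i))"
proof -
  interpret M: product_prob_space M by fact
  interpret M': product_prob_space M' by fact
  have sets [simp]: "sets (M' i) = sets (M i)" if "i \<in> J" for i using dens[OF that] by simp
  have meas: "(\<lambda>x. \<Prod>i\<in>J. f i (x i)) \<in> borel_measurable (PiM J M)"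
    using f by (intro borel_measurable_prod_ennreal) auto
  have "density (PiM J M) (\<lambda>x. \<Prod>i\<in>J. f i (x i)) = PiM J M'"
  proof (rule M'.PiM_eqI)
    show "sets (density (PiM J M) (\<lambda>x. \<Prod>i\<in>J. f i (x i))) = sets (PiM J M')"
      by (simp, rule sets_PiM_cong) (simp_all add: sets)
    fix A assume "\<And>i. i \<in> J \<Longrightarrow> A i \<in> sets (M' i)"
    hence A: "\<And>i. i \<in> J \<Longrightarrow> A i \<in> sets (M i)" by simp
    have "emeasure (density (PiM J M) (\<lambda>x. \<Prod>i\<in>J. f i (x i))) (Pi\<^sub>E J A) =
          (\<integral>\<^sup>+x. (\<Prod>i\<in>J. f i (x i)) * indicator (Pi\<^sub>E J A) x \<partial>PiM J M)"
      using A assms(3) by (intro emeasure_density meas sets_PiM_I_finite) auto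
    also have "\<dots> = (\<integral>\<^sup>+x. (\<Prod>i\<in>J. f i (x i) * indicator (A i) (x i)) \<partial>PiM J M)"
    proof (rule nn_integral_cong)
      fix x assume "x \<in> space (PiM J M)"
      hence "x \<in> Pi\<^sub>E J A \<longleftrightarrow> (\<forall>i\<in>J. x i \<in> A i)" by (auto simp: space_PiM PiE_iff)
      hence "indicator (Pi\<^sub>E J A) x = (\<Prod>i\<in>J. indicator (A i) (x i) :: ennreal)"
        using assms(3) by (cases "\<forall>i\<in>J. x i \<in> A i") (auto simp: indicator_def)
      thus "(\<Prod>i\<in>J. f i (x i)) * indicator (Pi\<^sub>E J A) x = (\<Prod>i\<in>J. f i (x i) * indicator (A i) (x i))"
        by (simp add: prod.distrib)
    qed
    also have "\<dots> = (\<Prod>i\<in>J. \<integral>\<^sup>+x. f i x * indicator (A i) x \<partial>M i)"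
      using f A assms(3) by (intro M.product_nn_integral_prod) auto
    also have "\<dots> = (\<Prod>i\<in>J. emeasure (M' i) (A i))"
      using f A by (intro prod.cong refl) (simp add: dens emeasure_density)
    finally show "emeasure (density (PiM J M) (\<lambda>x. \<Prod>i\<in>J. f i (x i))) (Pi\<^sub>E J A) =
          (\<Prod>i\<in>J. emeasure (M' i) (A i))" .
  qed (fact assms)
  thus ?thesis ..
qed

text \<open>Infinite products of equivalent laws may be mutually singular, so a density exists in
  general only for finitely many coordinates. As \<open>g\<close> depends on \<open>J\<close> alone,
  both integrals are computed on the finite product.\<close>

lemma integral_PiM_change_of_measure:
  fixes g :: "('i \<Rightarrow> 'a) \<Rightarrow> real" and f :: "'i \<Rightarrow> 'a \<Rightarrow> real"
  assumes M: "product_prob_space M" and M': "product_prob_space M'" and J: "finite J" "J \<subseteq> I"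
    and f: "\<And>i. i \<in> J \<Longrightarrow> f i \<in> borel_measurable (M i)" "\<And>i x. i \<in> J \<Longrightarrow> 0 \<le> f i x"
    and dens: "\<And>i. i \<in> J \<Longrightarrow> M' i = density (M i) (\<lambda>x. ennreal (f i x))"
    and sets: "\<And>i. i \<in> I \<Longrightarrow> sets (M' i) = sets (M i)"
    and g: "g \<in> borel_measurable (PiM I M)"
    and dep: "\<And>x y. (\<And>i. i \<in> J \<Longrightarrow> x i = y i) \<Longrightarrow> g x = g y"
  shows "(\<integral>x. g x \<partial>PiM I M') = (\<integral>x. (\<Prod>i\<in>J. f i (x i)) * g x \<partial>PiM I M)"
proof -
  interpret M: product_prob_space M I by (rule M)
  interpret M': product_prob_space M' I by (rule M')
  \<comment> \<open>Filler values outside \<open>J\<close>: with them \<open>e\<close> completes a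
    point of the finite product to one at which \<open>g\<close> can be evaluated.\<close>
  define c where "c = (\<lambda>i. SOME y. y \<in> space (M i))"
  have c: "c i \<in> space (M i)" for i
    unfolding c_def some_in_eq by (rule M.M.not_empty)
  define e where "e = (\<lambda>x. \<lambda>i\<in>I. if i \<in> J then x i else c i)"
  have e: "e \<in> measurable (PiM J M) (PiM I M)"
    unfolding e_def
  proof (rule measurable_restrict)
    fix i assume "i \<in> I"
    show "(\<lambda>x. if i \<in> J then x i else c i) \<in> measurable (PiM J M) (M i)"
      using c by (cases "i \<in> J") auto
  qed
  have ge: "(\<lambda>x. g (e x)) \<in> borel_measurable (PiM J M)" using measurable_compose[OF e g] .
  have prod_meas: "(\<lambda>x. \<Prod>i\<in>J. f i (x i)) \<in> borel_measurable (PiM J M)"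
  proof (rule borel_measurable_prod)
    fix i assume i: "i \<in> J"
    show "(\<lambda>x. f i (x i)) \<in> borel_measurable (PiM J M)"
      by (rule measurable_compose[OF _ f(1)[OF i]], rule measurable_component_singleton[OF i])
  qed
  have ge_eq: "g (e (restrict x J)) = g x" for x
    using J by (intro dep) (auto simp: e_def)
  have setsJ: "sets (PiM J M') = sets (PiM J M)" "sets (PiM I M') = sets (PiM I M)"
    using sets J by (auto intro!: sets_PiM_cong)
  have rM: "(\<lambda>x. restrict x J) \<in> measurable (PiM I M) (PiM J M)"
    using J by (intro measurable_restrict_subset)
  hence rM': "(\<lambda>x. restrict x J) \<in> measurable (PiM I M') (PiM J M')"
    using measurable_cong_sets[OF setsJ(2) setsJ(1)] by simp
  have "(\<integral>x. g x \<partial>PiM I M') = (\<integral>x. g (e (restrict x J)) \<partial>PiM I M')" by (simp add: ge_eq)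
  also have "\<dots> = (\<integral>x. g (e x) \<partial>PiM J M')"
    using ge by (subst M'.distr_PiM_restrict_finite[OF J, symmetric], subst integral_distr[OF rM'])
      (auto simp: measurable_cong_sets[OF setsJ(1) refl])
  also have "PiM J M' = density (PiM J M) (\<lambda>x. \<Prod>i\<in>J. ennreal (f i (x i)))"
    using M M' J(1) by (rule PiM_density) (use f dens in auto)
  also have "\<dots> = density (PiM J M) (\<lambda>x. ennreal (\<Prod>i\<in>J. f i (x i)))"
    using f by (simp add: prod_ennreal)
  also have "(\<integral>x. g (e x) \<partial>\<dots>) = (\<integral>x. (\<Prod>i\<in>J. f i (x i)) * g (e x) \<partial>PiM J M)"
    by (rule integral_real_density) (use ge prod_meas f in \<open>auto intro!: prod_nonneg\<close>)
  also have "\<dots> = (\<integral>x. (\<Prod>i\<in>J. f i (restrict x J i)) * g (e (restrict x J)) \<partial>PiM I M)"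
    using prod_meas ge by (subst M.distr_PiM_restrict_finite[OF J, symmetric], subst integral_distr[OF rM])
      auto
  finally show ?thesis by (simp add: ge_eq)
qed

context bandit_run
begin

text \<open>\<open>product_prob_space\<close> wants a probability measure at every index, so indices
  without an arm receive a point mass. On the index set of the table the laws are unchanged.\<close>

definition total_law :: "nat \<times> nat \<Rightarrow> real measure" where
  "total_law p = (if fst p < K then \<nu> ! fst p else return borel 0)"

lemma prob_space_total_law: "prob_space (total_law p)"
  unfolding total_law_def using prob_laws by (auto intro!: prob_space_return)

lemma sets_total_law [simp]: "sets (total_law p) = sets borel"
  unfolding total_law_def using sets_laws by auto

lemma reward_table_eq: "reward_table \<nu> = PiM ({..<K} \<times> {1..}) total_law"
  unfolding reward_table_def total_law_def by (rule PiM_cong) auto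

lemma product_prob_space_total_law: "product_prob_space total_law"
  by (intro product_prob_spaceI prob_space_total_law)

end

sublocale bandit_run \<subseteq> table: product_prob_space total_law "{..<K} \<times> {1..}"
  by (rule product_prob_space_total_law)

lemma square_integral_pmf_le:
  fixes F :: "'a \<Rightarrow> real"
  assumes "finite (set_pmf p)"
  shows "(\<integral>x. F x \<partial>measure_pmf p)\<^sup>2 \<le> (\<integral>x. (F x)\<^sup>2 \<partial>measure_pmf p)"
proof -
  have "0 \<le> measure_pmf.variance p F" by (rule integral_nonneg_AE) auto
  also have "\<dots> = (\<integral>x. (F x)\<^sup>2 \<partial>measure_pmf p) - (\<integral>x. F x \<partial>measure_pmf p)\<^sup>2"
    using assms by (intro measure_pmf.variance_eq integrable_measure_pmf_finite)
  finally show ?thesis by simp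
qed

text \<open>Weighted AM-GM, from a nonnegative square. The weight is chosen later, which keeps
  square roots of integrals out of the estimates.\<close>

lemma two_abs_mult_le:
  fixes a b c :: real
  assumes "c > 0"
  shows "2 * \<bar>a * b\<bar> \<le> c * a\<^sup>2 + b\<^sup>2 / c"
proof -
  have "0 \<le> (c * \<bar>a\<bar> - \<bar>b\<bar>)\<^sup>2 / c" using assms by simp
  also have "\<dots> = c * \<bar>a\<bar>\<^sup>2 + \<bar>b\<bar>\<^sup>2 / c - 2 * \<bar>a * b\<bar>"
    using assms unfolding abs_mult by (simp add: power2_eq_square field_simps del: abs_mult_self_eq)
  finally show ?thesis by simp
qed

text \<open>
  The Hammersley--Chapman--Robbins bound for the number of pulls, with Cauchy--Schwarz replaced
  by its AM-GM form with weight \<open>c\<close>.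
\<close>

lemma (in bandit_run) expected_pulls_change_of_measure:
  fixes f :: "nat \<Rightarrow> real \<Rightarrow> real"
  assumes run': "bandit_run \<nu>' \<pi>" and len: "length \<nu>' = K"
    and dens: "\<And>i. i < K \<Longrightarrow> \<nu>' ! i = density (\<nu> ! i) (\<lambda>x. ennreal (f i x))"
    and f: "\<And>i. i < K \<Longrightarrow> f i \<in> borel_measurable borel" "\<And>i x. 0 \<le> f i x" "\<And>i x. f i x \<le> B"
    and c: "c > 0"
  shows "\<bar>expected_pulls \<pi> \<nu>' T k - expected_pulls \<pi> \<nu> T k\<bar> \<le>
    (c * variance_pulls \<pi> \<nu> T k + ((\<Prod>i<K. \<integral>x. (f i x)\<^sup>2 \<partial>(\<nu> ! i)) ^ T - 1) / c) / 2"
proof -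
  interpret R: bandit_run \<nu>' \<pi> by fact
  \<comment> \<open>The block of rewards that a run of length \<open>T\<close> can read;
    \<open>L\<close> is the likelihood ratio of this block.\<close>
  define J where "J = {..<K} \<times> {1..T}"
  have J: "finite J" "J \<subseteq> {..<K} \<times> {1..}" by (auto simp: J_def)
  define g where "g = (\<lambda>x. \<integral>as. real (count_list as k) \<partial>actions \<pi> x T)"
  define L where "L = (\<lambda>x :: nat \<times> nat \<Rightarrow> real. \<Prod>p\<in>J. f (fst p) (x p))"
  define m where "m = expected_pulls \<pi> \<nu> T k"
  note borel_cong = measurable_cong_sets[OF sets_total_law refl]
  have bound: "integrable (total_law p) h" 
    if "h \<in> borel_measurable borel" "\<And>x. 0 \<le> h x" "\<And>x. h x \<le> D" for p D and h :: "real \<Rightarrow> real"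
  proof -
    show ?thesis using that
      by (intro finite_measure.integrable_const_bound[of _ _ D] prob_space.finite_measure
          prob_space_total_law) (auto simp: borel_cong)
  qed
  have B0: "0 \<le> B" using f(2)[of 0 0] f(3)[of 0 0] by linarith
  have law: "total_law p = \<nu> ! fst p" if "p \<in> J" for p using that by (auto simp: total_law_def J_def)
  have f1: "integrable (total_law p) (f (fst p))" if "p \<in> J" for p
    using that f by (intro bound[of _ B]) (auto simp: J_def)
  have L_int: "integrable (reward_table \<nu>) L"
    and L_eq: "(\<integral>x. L x \<partial>reward_table \<nu>) = (\<Prod>p\<in>J. \<integral>x. f (fst p) x \<partial>total_law p)"
    unfolding L_def reward_table_eq
    by (rule table.integrable_prod_components[OF J f1] table.integral_prod_components[OF J f1]; assumption)+
  have "(\<integral>x. f i x \<partial>(\<nu> ! i)) = 1" if i: "i < K" for i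
  proof -
    have "prob_space (\<nu>' ! i)" using R.prob_laws i len by simp
    note this[THEN prob_space.prob_space, simp]
    have meas: "f i \<in> borel_measurable (\<nu> ! i)" 
      using f(1)[OF i] by (simp add: measurable_cong_sets[OF sets_laws[OF i] refl])
    have "1 = (\<integral>x. (1::real) \<partial>(\<nu>' ! i))" by simp
    also have "\<dots> = (\<integral>x. f i x * 1 \<partial>(\<nu> ! i))"
      unfolding dens[OF i] using f meas by (intro integral_real_density) auto
    finally show ?thesis by simp
  qed
  hence L1: "(\<integral>x. L x \<partial>reward_table \<nu>) = 1"
    unfolding L_eq by (intro prod.neutral) (auto simp: law J_def total_law_def)
  have "(\<lambda>x. (L x)\<^sup>2) = (\<lambda>x. \<Prod>p\<in>J. (f (fst p) (x p))\<^sup>2)"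
    by (simp add: L_def prod_power_distrib)
  moreover have f2: "integrable (total_law p) (\<lambda>x. (f (fst p) x)\<^sup>2)" if "p \<in> J" for p
    using that f by (intro bound[of _ "B\<^sup>2"]) (auto simp: J_def intro!: power_mono)
  ultimately have L2_int: "integrable (reward_table \<nu>) (\<lambda>x. (L x)\<^sup>2)"
    and L2_eq: "(\<integral>x. (L x)\<^sup>2 \<partial>reward_table \<nu>) = (\<Prod>p\<in>J. \<integral>x. (f (fst p) x)\<^sup>2 \<partial>total_law p)"
    using table.integrable_prod_components[OF J f2] table.integral_prod_components[OF J f2]
    by (simp_all add: reward_table_eq)
  have "(\<Prod>p\<in>J. \<integral>x. (f (fst p) x)\<^sup>2 \<partial>total_law p) =
        (\<Prod>p\<in>{..<K} \<times> {1..T}. \<integral>x. (f (fst p) x)\<^sup>2 \<partial>(\<nu> ! fst p))"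
    using law by (auto simp: J_def intro!: prod.cong)
  also have "\<dots> = (\<Prod>i<K. \<Prod>s\<in>{1..T}. \<integral>x. (f i x)\<^sup>2 \<partial>(\<nu> ! i))"
    by (subst prod.cartesian_product) (auto intro!: prod.cong)
  also have "\<dots> = (\<Prod>i<K. \<integral>x. (f i x)\<^sup>2 \<partial>(\<nu> ! i)) ^ T"
    by (simp add: prod_power_distrib)
  finally have L2: "(\<integral>x. (L x)\<^sup>2 \<partial>reward_table \<nu>) = (\<Prod>i<K. \<integral>x. (f i x)\<^sup>2 \<partial>(\<nu> ! i)) ^ T"
    using L2_eq by simp
  have g_meas: "g \<in> borel_measurable (reward_table \<nu>)"
    unfolding g_def by (rule measurable_integral_actions)
  have g_bound: "0 \<le> g x" "g x \<le> T" for x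
    unfolding g_def
    by (rule integral_actions_bounds[where a = 0 and b = "real T"],
        use actions_in_pull_lists[of x T] count_list_le_horizon[of _ K T k] in auto)+
  have "expected_pulls \<pi> \<nu>' T k = (\<integral>x. g x \<partial>reward_table \<nu>')"
    unfolding R.expected_pulls_eq g_def ..
  also have "\<dots> = (\<integral>x. L x * g x \<partial>reward_table \<nu>)"
    unfolding reward_table_eq R.reward_table_eq len L_def
  proof (rule integral_PiM_change_of_measure[OF product_prob_space_total_law R.product_prob_space_total_law])
    fix p assume p: "p \<in> J"
    thus "R.total_law p = density (total_law p) (\<lambda>x. ennreal (f (fst p) x))"
      using dens len by (auto simp: J_def total_law_def R.total_law_def)
    show "f (fst p) \<in> borel_measurable (total_law p)"
      using p f(1) by (auto simp: J_def borel_cong)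
  next
    fix x y :: "nat \<times> nat \<Rightarrow> real" assume "\<And>p. p \<in> J \<Longrightarrow> x p = y p"
    hence "actions \<pi> x T = actions \<pi> y T"
      by (intro actions_cong[OF set_pmf_policy]) (auto simp: J_def)
    thus "g x = g y" by (simp add: g_def)
  qed (use J f g_meas in \<open>auto simp: reward_table_eq\<close>)
  finally have E': "expected_pulls \<pi> \<nu>' T k = (\<integral>x. L x * g x \<partial>reward_table \<nu>)" .
  have g_int: "integrable (reward_table \<nu>) g" unfolding g_def by (rule integrable_integral_actions)
  have gm: "(\<integral>x. g x \<partial>reward_table \<nu>) = m" by (simp add: m_def g_def expected_pulls_eq)
  have Lg_int: "integrable (reward_table \<nu>) (\<lambda>x. L x * g x)"
  proof (rule Bochner_Integration.integrable_bound[where f = "\<lambda>x. T * L x"])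
    have "0 \<le> L x" for x unfolding L_def using f by (intro prod_nonneg) auto
    thus "AE x in reward_table \<nu>. norm (L x * g x) \<le> norm (T * L x)"
      using g_bound by (auto simp: abs_mult mult.commute intro!: mult_left_mono AE_I2)
  qed (use L_int g_meas in auto)
  \<comment> \<open>Since \<open>L\<close> has integral 1, the change of the expectation is the
    covariance of \<open>g\<close> and \<open>L\<close>. Centring \<open>g\<close> is what brings in
    the variance.\<close>
  have "expected_pulls \<pi> \<nu>' T k - m = (\<integral>x. (g x - m) * (L x - 1) \<partial>reward_table \<nu>)"
  proof -
    have "(\<integral>x. (g x - m) * (L x - 1) \<partial>reward_table \<nu>) =
          (\<integral>x. L x * g x - g x - m * L x + m \<partial>reward_table \<nu>)"
      by (simp add: algebra_simps)
    also have "\<dots> = (\<integral>x. L x * g x \<partial>reward_table \<nu>) - m - m * 1 + m"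
      using Lg_int g_int L_int L1 gm P.prob_space by simp
    finally show ?thesis using E' by simp
  qed
  also have "\<bar>\<dots>\<bar> \<le> (\<integral>x. \<bar>(g x - m) * (L x - 1)\<bar> \<partial>reward_table \<nu>)"
    by (rule integral_abs_bound)
  also have "\<dots> \<le> (\<integral>x. (c * (\<integral>as. (real (count_list as k) - m)\<^sup>2 \<partial>actions \<pi> x T) + (L x - 1)\<^sup>2 / c) / 2
                     \<partial>reward_table \<nu>)"
  proof (rule Bochner_Integration.integral_mono)
    have "integrable (reward_table \<nu>) (\<lambda>x. L x * g x - g x - m * L x + m)"
      using Lg_int g_int L_int by simp
    thus "integrable (reward_table \<nu>) (\<lambda>x. \<bar>(g x - m) * (L x - 1)\<bar>)"
      by (intro integrable_abs) (simp add: algebra_simps)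
    have "integrable (reward_table \<nu>) (\<lambda>x. (L x - 1)\<^sup>2)"
      using L2_int L_int by (simp add: power2_diff)
    thus "integrable (reward_table \<nu>)
      (\<lambda>x. (c * (\<integral>as. (real (count_list as k) - m)\<^sup>2 \<partial>actions \<pi> x T) + (L x - 1)\<^sup>2 / c) / 2)"
      using integrable_integral_actions by simp
    fix x
    have fin: "finite (set_pmf (actions \<pi> x T))" 
      using finite_subset[OF actions_in_pull_lists] by simp
    \<comment> \<open>\<open>g\<close> averages over the internal randomness of the policy. By
      Jensen its squared deviation is at most the conditional second moment, whose integral is the
      variance of the count.\<close>
    have "g x - m = (\<integral>as. (real (count_list as k) - m) \<partial>actions \<pi> x T)"
      using fin by (simp add: g_def integrable_measure_pmf_finite)
    hence "(g x - m)\<^sup>2 \<le> (\<integral>as. (real (count_list as k) - m)\<^sup>2 \<partial>actions \<pi> x T)"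
      using square_integral_pmf_le[OF fin] by simp
    hence "c * (g x - m)\<^sup>2 \<le> c * (\<integral>as. (real (count_list as k) - m)\<^sup>2 \<partial>actions \<pi> x T)"
      using c by (intro mult_left_mono) auto
    moreover have "2 * \<bar>(g x - m) * (L x - 1)\<bar> \<le> c * (g x - m)\<^sup>2 + (L x - 1)\<^sup>2 / c"
      using c by (rule two_abs_mult_le)
    ultimately show "\<bar>(g x - m) * (L x - 1)\<bar> \<le>
        (c * (\<integral>as. (real (count_list as k) - m)\<^sup>2 \<partial>actions \<pi> x T) + (L x - 1)\<^sup>2 / c) / 2" by simp
  qed
  also have "\<dots> = (c * variance_pulls \<pi> \<nu> T k + (\<integral>x. (L x - 1)\<^sup>2 \<partial>reward_table \<nu>) / c) / 2"
    using integrable_integral_actions L2_int L_int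
    by (simp add: variance_pulls_eq m_def power2_diff)
  also have "(\<integral>x. (L x - 1)\<^sup>2 \<partial>reward_table \<nu>) = (\<Prod>i<K. \<integral>x. (f i x)\<^sup>2 \<partial>(\<nu> ! i)) ^ T - 1"
    using L2_int L_int L1 L2 P.prob_space by (simp add: power2_diff)
  finally show ?thesis by (simp add: m_def)
qed

subsection \<open>Two-point bandits\<close>

lemma sg_classD:
  assumes "\<nu> \<in> sg_class M \<sigma> Kbar"
  shows "2 \<le> length \<nu>" "length \<nu> \<le> Kbar"
    and "\<And>i. i < length \<nu> \<Longrightarrow> prob_space (\<nu> ! i)"
    and "\<And>i. i < length \<nu> \<Longrightarrow> sets (\<nu> ! i) = sets borel"
    and "\<And>i. i < length \<nu> \<Longrightarrow> mean (\<nu> ! i) \<in> {-M..M}"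
    and "\<And>i. i < length \<nu> \<Longrightarrow> sub_gaussian \<sigma> (\<nu> ! i)"
  using assms unfolding sg_class_def by auto

lemma bandit_run_sg_class:
  assumes "\<nu> \<in> sg_class M \<sigma> Kbar" "is_policy (length \<nu>) \<pi>"
  shows "bandit_run \<nu> \<pi>"
  using sg_classD[OF assms(1)] assms(2) by (simp add: bandit_run_def)

lemma bandit_run_algorithm:
  assumes "is_algorithm alg" "\<nu> \<in> sg_class M \<sigma> Kbar"
  shows "bandit_run \<nu> (alg T (length \<nu>))"
  using assms sg_classD(1)[OF assms(2)] by (intro bandit_run_sg_class) (auto simp: is_algorithm_def)

lemma gap_bounds:
  assumes \<nu>: "\<nu> \<in> sg_class M \<sigma> Kbar" and i: "i < length \<nu>"
  shows "0 \<le> gap \<nu> i" "gap \<nu> i \<le> 2 * M"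
proof -
  let ?A = "(\<lambda>j. mean (\<nu> ! j)) ` {..<length \<nu>}"
  have "mean (\<nu> ! i) \<le> Max ?A" using i by (intro Max_ge) auto
  thus "0 \<le> gap \<nu> i" by (simp add: gap_def)
  have "Max ?A \<le> M" using i sg_classD(5)[OF \<nu>] by (subst Max_le_iff) auto
  thus "gap \<nu> i \<le> 2 * M" using sg_classD(5)[OF \<nu> i] by (simp add: gap_def)
qed

lemma regret_bounds:
  assumes "is_algorithm alg" and \<nu>: "\<nu> \<in> sg_class M \<sigma> Kbar"
  shows "0 \<le> regret alg \<nu> T" "regret alg \<nu> T \<le> 2 * M * T"
proof -
  interpret bandit_run \<nu> "alg T (length \<nu>)" by (rule bandit_run_algorithm[OF assms])
  show "0 \<le> regret alg \<nu> T"
    unfolding regret_def using gap_bounds[OF \<nu>] expected_pulls_bounds by (intro sum_nonneg) auto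
  have "regret alg \<nu> T \<le> (\<Sum>i<length \<nu>. 2 * M * expected_pulls (alg T (length \<nu>)) \<nu> T i)"
    unfolding regret_def using gap_bounds[OF \<nu>] expected_pulls_bounds
    by (intro sum_mono mult_right_mono) auto
  thus "regret alg \<nu> T \<le> 2 * M * T"
    by (simp add: sum_expected_pulls flip: sum_distrib_left)
qed

lemma sqrt_variance_le_variability:
  assumes "i < length \<nu>"
  shows "sqrt (variance_pulls (alg T (length \<nu>)) \<nu> T i) \<le> variability alg \<nu> T"
  unfolding variability_def using assms by (intro Max_ge) auto

lemma variability_le:
  assumes "length \<nu> > 0"
    and "\<And>i. i < length \<nu> \<Longrightarrow> sqrt (variance_pulls (alg T (length \<nu>)) \<nu> T i) \<le> b"
  shows "variability alg \<nu> T \<le> b"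
  unfolding variability_def using assms by (subst Max_le_iff) auto

lemma variability_bounds:
  assumes "is_algorithm alg" and \<nu>: "\<nu> \<in> sg_class M \<sigma> Kbar"
  shows "0 \<le> variability alg \<nu> T" "variability alg \<nu> T \<le> T"
proof -
  interpret bandit_run \<nu> "alg T (length \<nu>)" by (rule bandit_run_algorithm[OF assms])
  have pos: "0 < length \<nu>" using sg_classD(1)[OF \<nu>] by linarith
  have "0 \<le> sqrt (variance_pulls (alg T (length \<nu>)) \<nu> T 0)" using variance_pulls_bounds by simp
  also have "\<dots> \<le> variability alg \<nu> T" by (rule sqrt_variance_le_variability[OF pos])
  finally show "0 \<le> variability alg \<nu> T" .
  show "variability alg \<nu> T \<le> T"
    using pos variance_pulls_bounds by (intro variability_le real_le_lsqrt) auto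
qed

lemma regret_le_worst_regret:
  assumes "is_algorithm alg" "\<nu> \<in> sg_class M \<sigma> Kbar"
  shows "regret alg \<nu> T \<le> worst_regret M \<sigma> Kbar alg T"
  unfolding worst_regret_def using regret_bounds(2)[OF assms(1), of _ M \<sigma> Kbar] assms(2)
  by (intro cSUP_upper bdd_aboveI2[where M = "2 * M * T"])

lemma variability_le_worst_variability:
  assumes "is_algorithm alg" "\<nu> \<in> sg_class M \<sigma> Kbar"
  shows "variability alg \<nu> T \<le> worst_variability M \<sigma> Kbar alg T"
  unfolding worst_variability_def using variability_bounds(2)[OF assms(1), of _ M \<sigma> Kbar] assms(2)
  by (intro cSUP_upper bdd_aboveI2[where M = "real T"])

section \<open>Reward laws with two atoms\<close>

definition two_point :: "real \<Rightarrow> real \<Rightarrow> real measure" where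
  "two_point \<sigma> p = distr (measure_pmf (bernoulli_pmf p)) borel (\<lambda>b. if b then \<sigma> else - \<sigma>)"

lemma sets_two_point [simp, measurable_cong]: "sets (two_point \<sigma> p) = sets borel"
  by (simp add: two_point_def)

lemma prob_space_two_point: "prob_space (two_point \<sigma> p)"
  unfolding two_point_def by (intro measure_pmf.prob_space_distr) auto

lemma integral_two_point:
  fixes f :: "real \<Rightarrow> real"
  assumes "f \<in> borel_measurable borel" "0 \<le> p" "p \<le> 1"
  shows "(\<integral>x. f x \<partial>two_point \<sigma> p) = f \<sigma> * p + f (- \<sigma>) * (1 - p)"
  unfolding two_point_def using assms by (subst integral_distr) auto

lemma integrable_two_point:
  fixes f :: "real \<Rightarrow> real"
  assumes "f \<in> borel_measurable borel"
  shows "integrable (two_point \<sigma> p) f"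
  unfolding two_point_def using assms by (subst integrable_distr_eq) (auto intro!: integrable_measure_pmf_finite)

lemma mean_two_point:
  assumes "0 \<le> p" "p \<le> 1"
  shows "mean (two_point \<sigma> p) = \<sigma> * (2 * p - 1)"
  unfolding mean_def using assms by (subst integral_two_point) (auto simp: algebra_simps)

text \<open>Hoeffding's lemma on an interval of length \<open>2 * \<sigma>\<close> gives the
  exponent \<open>l^2 * (2 * \<sigma>)^2 / 8\<close>, exactly the required one for every
  \<open>p\<close>. It needs a positive parameter, so for negative \<open>l\<close> the variable is
  reflected by \<open>sgn l\<close>.\<close>

lemma sub_gaussian_two_point:
  assumes p: "0 \<le> p" "p \<le> 1" and "\<sigma> > 0"
  shows "sub_gaussian \<sigma> (two_point \<sigma> p)"
proof -
  define m where "m = \<sigma> * (2 * p - 1)"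
  have *: "exp (l * (\<sigma> - m)) * p + exp (l * (- \<sigma> - m)) * (1 - p) \<le> exp (l\<^sup>2 * \<sigma>\<^sup>2 / 2)" for l
  proof (cases "l = 0")
    case False
    define f where "f = (\<lambda>b. sgn l * (if b then \<sigma> else - \<sigma>))"
    interpret interval_bounded_random_variable "measure_pmf (bernoulli_pmf p)" f "- \<sigma>" \<sigma>
      by unfold_locales (use False assms(3) in \<open>auto simp: f_def sgn_if\<close>)
    have E: "(\<integral>b. f b \<partial>measure_pmf (bernoulli_pmf p)) = sgn l * m"
      using p by (simp add: f_def m_def algebra_simps)
    have "(\<integral>\<^sup>+b. ennreal (exp (\<bar>l\<bar> * (f b - sgn l * m))) \<partial>measure_pmf (bernoulli_pmf p))
             \<le> ennreal (exp (\<bar>l\<bar>\<^sup>2 * (\<sigma> - - \<sigma>)\<^sup>2 / 8))"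
      using Hoeffdings_lemma_nn_integral[of "\<bar>l\<bar>"] False unfolding E by simp
    also have "(\<integral>\<^sup>+b. ennreal (exp (\<bar>l\<bar> * (f b - sgn l * m))) \<partial>measure_pmf (bernoulli_pmf p)) =
       ennreal (exp (l * (\<sigma> - m)) * p + exp (l * (- \<sigma> - m)) * (1 - p))"
    proof -
      have "\<bar>l\<bar> * (f b - sgn l * m) = l * ((if b then \<sigma> else - \<sigma>) - m)" for b
        by (simp add: f_def algebra_simps sgn_if abs_if)
      thus ?thesis using p by (simp add: ennreal_mult ennreal_plus)
    qed
    finally show ?thesis by (simp add: power2_eq_square mult_ac)
  qed (use p in simp)
  show ?thesis unfolding sub_gaussian_def mean_two_point[OF p] m_def[symmetric]
    using * p by (auto simp: integral_two_point intro!: integrable_two_point)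
qed

lemma two_point_density:
  assumes "0 < p" "p < 1" "0 \<le> q" "q \<le> 1" "\<sigma> > 0"
  shows "two_point \<sigma> q =
    density (two_point \<sigma> p) (\<lambda>x. ennreal (if x = \<sigma> then q / p else (1 - q) / (1 - p)))"
proof (rule measure_eqI)
  fix A assume "A \<in> sets (two_point \<sigma> q)"
  hence A: "A \<in> sets borel" by simp
  have e: "emeasure (two_point \<sigma> r) B = ennreal (indicator B \<sigma> * r + indicator B (- \<sigma>) * (1 - r))"
    if "0 \<le> r" "r \<le> 1" "B \<in> sets borel" for r B
  proof -
    interpret prob_space "two_point \<sigma> r" by (rule prob_space_two_point)
    show ?thesis using that integral_two_point[of "indicator B" r \<sigma>] by (simp add: emeasure_eq_measure)
  qed
  have "emeasure (density (two_point \<sigma> p) (\<lambda>x. ennreal (if x = \<sigma> then q / p else (1 - q) / (1 - p)))) A =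
      (\<integral>\<^sup>+x. ennreal ((if x = \<sigma> then q / p else (1 - q) / (1 - p)) * indicator A x) \<partial>two_point \<sigma> p)"
    using A by (subst emeasure_density) (auto intro!: nn_integral_cong simp: indicator_def)
  also have "\<dots> = ennreal (\<integral>x. (if x = \<sigma> then q / p else (1 - q) / (1 - p)) * indicator A x \<partial>two_point \<sigma> p)"
    using assms A by (intro nn_integral_eq_integral integrable_two_point) auto
  also have "\<dots> = emeasure (two_point \<sigma> q) A"
    using assms A by (subst integral_two_point) (auto simp: e mult.commute)
  finally show "emeasure (two_point \<sigma> q) A =
    emeasure (density (two_point \<sigma> p) (\<lambda>x. ennreal (if x = \<sigma> then q / p else (1 - q) / (1 - p)))) A" ..
qed simp

text \<open>Only the second arm varies, so a change of \<open>p\<close> affects \<open>T\<close>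
  rewards of one arm; at \<open>p = 1 / 2\<close> the two laws coincide.\<close>

definition two_point_bandit :: "real \<Rightarrow> real \<Rightarrow> bandit" where
  "two_point_bandit \<sigma> p = [two_point \<sigma> (1 / 2), two_point \<sigma> p]"

lemma length_two_point_bandit [simp]: "length (two_point_bandit \<sigma> p) = 2"
  by (simp add: two_point_bandit_def)

lemma two_point_bandit_in_class:
  assumes "1 / 2 \<le> p" "p \<le> 1" "\<sigma> * (2 * p - 1) \<le> M" "\<sigma> > 0" "M > 0" "Kbar \<ge> 2"
  shows "two_point_bandit \<sigma> p \<in> sg_class M \<sigma> Kbar"
proof -
  have "0 \<le> \<sigma> * (2 * p - 1)" using assms by (intro mult_nonneg_nonneg) auto
  hence "- M \<le> \<sigma> * (2 * p - 1)" using assms by linarith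
  thus ?thesis using assms
    by (auto simp: sg_class_def two_point_bandit_def mean_two_point prob_space_two_point
        intro!: sub_gaussian_two_point integrable_two_point)
qed

lemma gap_two_point_bandit:
  assumes "1 / 2 \<le> p" "p \<le> 1" "\<sigma> > 0"
  shows "gap (two_point_bandit \<sigma> p) 0 = \<sigma> * (2 * p - 1)" "gap (two_point_bandit \<sigma> p) 1 = 0"
proof -
  have "0 \<le> \<sigma> * (2 * p - 1)" using assms by (intro mult_nonneg_nonneg) auto
  thus "gap (two_point_bandit \<sigma> p) 0 = \<sigma> * (2 * p - 1)" "gap (two_point_bandit \<sigma> p) 1 = 0"
    using assms by (simp_all add: gap_def two_point_bandit_def mean_two_point numeral_2_eq_2 lessThan_Suc)
qed

text \<open>The second moment of a likelihood ratio is one plus the chi-square divergence. Here this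
  is exactly the squared shift times the Fisher information \<open>1 / (p * (1 - p))\<close> of a
  Bernoulli parameter.\<close>

lemma chi_square_two_point:
  assumes "0 < p" "p < 1" "\<sigma> > 0"
  shows "(\<integral>x. (if x = \<sigma> then q / p else (1 - q) / (1 - p))\<^sup>2 \<partial>two_point \<sigma> p) = 1 + (q - p)\<^sup>2 / (p * (1 - p))"
proof -
  have "(\<integral>x. (if x = \<sigma> then q / p else (1 - q) / (1 - p))\<^sup>2 \<partial>two_point \<sigma> p) =
      (q / p)\<^sup>2 * p + ((1 - q) / (1 - p))\<^sup>2 * (1 - p)"
    using assms by (subst integral_two_point) auto
  also have "(q / p)\<^sup>2 * p = q\<^sup>2 / p" using assms by (simp add: power2_eq_square)
  also have "((1 - q) / (1 - p))\<^sup>2 * (1 - p) = (1 - q)\<^sup>2 / (1 - p)" using assms by (simp add: power2_eq_square)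
  also have "q\<^sup>2 / p + (1 - q)\<^sup>2 / (1 - p) = 1 + (q - p)\<^sup>2 / (p * (1 - p))"
    using assms by (simp add: field_simps power2_eq_square)
  finally show ?thesis .
qed

text \<open>The change of measure bound for a small shift. Between \<open>1 / 2\<close> and
  \<open>3 / 4\<close> the Fisher information is at most 8, and \<open>hT\<close> keeps the total
  exponent \<open>8 * h^2 * T\<close> in the range where the exponential is bounded
  linearly.\<close>

lemma expected_pulls_two_point_step:
  assumes policy: "is_policy 2 \<pi>" and p: "1 / 2 \<le> p" "p + h \<le> 3 / 4" and h: "h \<ge> 0"
    and hT: "8 * h\<^sup>2 * T \<le> 1" and "\<sigma> > 0"
    and S: "variance_pulls \<pi> (two_point_bandit \<sigma> p) T k \<le> S\<^sup>2" "S > 0"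
  shows "\<bar>expected_pulls \<pi> (two_point_bandit \<sigma> (p + h)) T k - expected_pulls \<pi> (two_point_bandit \<sigma> p) T k\<bar>
          \<le> 4 * h * sqrt T * S"
proof (cases "h = 0 \<or> T = 0")
  case True
  thus ?thesis
  proof
    assume "T = 0"
    have "bandit_run (two_point_bandit \<sigma> q) \<pi>" for q
      using policy by (auto simp: bandit_run_def two_point_bandit_def prob_space_two_point less_Suc_eq numeral_2_eq_2)
    from bandit_run.expected_pulls_bounds[OF this, of _ 0 k] \<open>T = 0\<close> show ?thesis
      by (metis diff_self abs_zero order_antisym mult_zero_right real_sqrt_zero of_nat_0 mult_zero_left order_refl)
  qed simp
next
  case False
  hence pos: "h > 0" "T > 0" using h by auto
  have run: "bandit_run (two_point_bandit \<sigma> q) \<pi>" for q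
    using policy by (auto simp: bandit_run_def two_point_bandit_def prob_space_two_point less_Suc_eq numeral_2_eq_2)
  interpret bandit_run "two_point_bandit \<sigma> p" \<pi> by (rule run)
  define lr where "lr = (\<lambda>x. if x = \<sigma> then (p + h) / p else (1 - (p + h)) / (1 - p))"
  define f where "f = (\<lambda>i::nat. if i = 1 then lr else (\<lambda>_. 1))"
  \<comment> \<open>This weight makes the two summands \<open>c * S^2\<close> and
    \<open>16 * h^2 * T / c\<close> of the bound equal.\<close>
  define c where "c = 4 * h * sqrt T / S"
  have c: "c > 0" using pos S by (simp add: c_def)
  have p01: "0 < p" "p < 1" "0 \<le> p + h" "p + h \<le> 1" using p h by linarith+
  have "\<bar>expected_pulls \<pi> (two_point_bandit \<sigma> (p + h)) T k - expected_pulls \<pi> (two_point_bandit \<sigma> p) T k\<bar>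
     \<le> (c * variance_pulls \<pi> (two_point_bandit \<sigma> p) T k +
        ((\<Prod>i<K. \<integral>x. (f i x)\<^sup>2 \<partial>(two_point_bandit \<sigma> p ! i)) ^ T - 1) / c) / 2"
  proof (rule expected_pulls_change_of_measure[OF run _ _ _ _ _ c, where B = 2])
    fix i x
    show "0 \<le> f i x" using p h by (auto simp: f_def lr_def)
    show "f i x \<le> 2" using p h by (auto simp: f_def lr_def field_simps)
  next
    fix i assume "i < K"
    thus "two_point_bandit \<sigma> (p + h) ! i = density (two_point_bandit \<sigma> p ! i) (\<lambda>x. ennreal (f i x))"
      using two_point_density[OF p01 \<open>\<sigma> > 0\<close>]
      by (auto simp: two_point_bandit_def f_def lr_def less_Suc_eq numeral_2_eq_2 density_1)
    show "f i \<in> borel_measurable borel" by (simp add: f_def lr_def)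
  qed simp
  also have "(\<Prod>i<K. \<integral>x. (f i x)\<^sup>2 \<partial>(two_point_bandit \<sigma> p ! i)) = 1 + h\<^sup>2 / (p * (1 - p))"
  proof -
    interpret half: prob_space "two_point \<sigma> (1 / 2)" by (rule prob_space_two_point)
    show ?thesis using chi_square_two_point[OF p01(1,2) \<open>\<sigma> > 0\<close>, of "p + h"] half.prob_space
      by (simp add: two_point_bandit_def f_def lr_def numeral_2_eq_2 lessThan_Suc)
  qed
  also have "(1 + h\<^sup>2 / (p * (1 - p))) ^ T \<le> 1 + 16 * h\<^sup>2 * T"
  proof -
    have "1 / 8 \<le> p * (1 - p)"
    proof -
      have "0 \<le> (p - 1 / 2) * (3 / 4 - p)" using p h by (intro mult_nonneg_nonneg) auto
      moreover have "(p - 1 / 2) * (3 / 4 - p) = p * (1 - p) + p / 4 - 3 / 8"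
        by (simp add: field_simps)
      ultimately show ?thesis using p h by linarith
    qed
    hence "h\<^sup>2 / (p * (1 - p)) \<le> h\<^sup>2 / (1 / 8)" by (intro divide_left_mono) auto
    hence "h\<^sup>2 / (p * (1 - p)) \<le> 8 * h\<^sup>2" by simp
    hence "1 + h\<^sup>2 / (p * (1 - p)) \<le> exp (8 * h\<^sup>2)" 
      using exp_ge_add_one_self[of "8 * h\<^sup>2"] by linarith
    moreover have "0 \<le> 1 + h\<^sup>2 / (p * (1 - p))" using p01 by simp
    ultimately have "(1 + h\<^sup>2 / (p * (1 - p))) ^ T \<le> exp (8 * h\<^sup>2) ^ T" by (intro power_mono)
    also have "\<dots> = exp (8 * h\<^sup>2 * T)" by (simp add: exp_of_nat_mult mult.commute)
    \<comment> \<open>For \<open>y\<close> in \<open>[0, 1]\<close>,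
      \<open>exp y \<le> 1 + y + y^2 \<le> 1 + 2 * y\<close>.\<close>
    also have "\<dots> \<le> 1 + 8 * h\<^sup>2 * T + (8 * h\<^sup>2 * T)\<^sup>2" using hT by (intro exp_bound) auto
    also have "(8 * h\<^sup>2 * T)\<^sup>2 \<le> 8 * h\<^sup>2 * T"
      using hT mult_left_mono[of "8 * h\<^sup>2 * T" 1 "8 * h\<^sup>2 * T"] by (simp add: power2_eq_square)
    finally show ?thesis by (simp add: mult_ac)
  qed
  hence "(c * variance_pulls \<pi> (two_point_bandit \<sigma> p) T k + ((1 + h\<^sup>2 / (p * (1 - p))) ^ T - 1) / c) / 2
     \<le> (c * S\<^sup>2 + 16 * h\<^sup>2 * T / c) / 2"
    using S c by (intro divide_right_mono add_mono mult_left_mono) auto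
  also have "\<dots> = 4 * h * sqrt T * S"
  proof -
    have "c * S\<^sup>2 = 4 * h * sqrt T * S" using S by (simp add: c_def power2_eq_square)
    moreover have "16 * h\<^sup>2 * T = 4 * h * sqrt T * S * c"
    proof -
      have "4 * h * sqrt T * S * c = 16 * h\<^sup>2 * (sqrt T)\<^sup>2"
        using S by (simp add: c_def power2_eq_square del: real_sqrt_mult_self)
      thus ?thesis by simp
    qed
    hence "16 * h\<^sup>2 * T / c = 4 * h * sqrt T * S" using c by (simp add: divide_eq_eq del: mult.assoc)
    ultimately show ?thesis by simp
  qed
  finally show ?thesis .
qed

subsection \<open>The lower bound\<close>

text \<open>Every arm gets at least one expected pull, and on an instance with a strictly worse arm
  this pull costs something. The lower bound divides by the regret.\<close>

lemma worst_regret_pos: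
  assumes pos: "M > 0" "\<sigma> > 0" "Kbar \<ge> 2" and T: "T \<ge> 2"
    and alg: "is_algorithm alg" "standing_assumptions M \<sigma> Kbar alg"
  shows "worst_regret M \<sigma> Kbar alg T > 0"
proof -
  \<comment> \<open>Strictly biased, yet with \<open>p \<le> 3 / 4\<close> and mean
    \<open>\<sigma> * (2 * p - 1) \<le> M\<close>.\<close>
  define p where "p = 1 / 2 + min (1 / 4) (M / (2 * \<sigma>))"
  have "min (1 / 4) (M / (2 * \<sigma>)) \<le> 1 / 4" "0 < min (1 / 4) (M / (2 * \<sigma>))" using pos by auto
  hence p: "1 / 2 \<le> p" "p \<le> 1" "1 / 2 < p" unfolding p_def by linarith+
  have "\<sigma> * (2 * p - 1) \<le> \<sigma> * (2 * (M / (2 * \<sigma>)))"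
    using pos by (intro mult_left_mono) (auto simp: p_def)
  hence in_class: "two_point_bandit \<sigma> p \<in> sg_class M \<sigma> Kbar" 
    using p pos by (intro two_point_bandit_in_class) auto
  have "1 \<le> expected_pulls (alg T 2) (two_point_bandit \<sigma> p) T 0"
    using alg(2) in_class T unfolding standing_assumptions_def
    by (metis length_two_point_bandit zero_less_numeral)
  moreover have "0 < \<sigma> * (2 * p - 1)" using p pos by simp
  ultimately have "0 < regret alg (two_point_bandit \<sigma> p) T"
    using gap_two_point_bandit[OF p(1,2) pos(2)] by (simp add: regret_def numeral_2_eq_2 lessThan_Suc)
  also have "\<dots> \<le> worst_regret M \<sigma> Kbar alg T" by (rule regret_le_worst_regret[OF alg(1) in_class])
  finally show ?thesis .
qed

text \<open>
  The mean of the second arm is raised from \<open>0\<close> to \<open>4 R / T\<close>, where \<open>R\<close> is the worst-case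
  regret. This moves the expected number of pulls of the first arm from \<open>T / 2\<close> to at most
  \<open>T / 4\<close>, in \<open>n\<close> steps that are small enough for the chi-square divergences to be
  linearised.
\<close>

lemma worst_regret_times_variability_ge:
  assumes pos: "M > 0" "\<sigma> > 0" "Kbar \<ge> 2" and T: "T \<ge> 2"
    and alg: "is_algorithm alg" "standing_assumptions M \<sigma> Kbar alg"
  defines "R \<equiv> worst_regret M \<sigma> Kbar alg T"
  assumes small: "R / T \<le> M / 4" "R / T \<le> \<sigma> / 8"
  shows "\<sigma> / 32 * T powr (3/2) \<le> R * worst_variability M \<sigma> Kbar alg T"
proof -
  define S where "S = worst_variability M \<sigma> Kbar alg T"
  have R: "R > 0" unfolding R_def by (rule worst_regret_pos[OF pos T alg])
  \<comment> \<open>The total shift of the parameter: the second mean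
    \<open>\<sigma> * (2 * p - 1)\<close> ends at
    \<open>2 * \<sigma> * D = 4 * R / T\<close>.\<close>
  define D where "D = 2 * R / (\<sigma> * T)"
  \<comment> \<open>Enough steps for \<open>h \<le> 1 / (4 * sqrt T)\<close>, hence
    \<open>16 * h^2 * T \<le> 1\<close>, which is more than a single step demands.\<close>
  define n where "n = nat \<lceil>4 * sqrt T * D\<rceil>"
  define h where "h = D / n"
  have T0: "real T > 0" using T by simp
  have D: "0 < D" "D \<le> 1 / 4" using R pos T small(2) by (auto simp: D_def field_simps)
  have n: "4 * sqrt T * D \<le> n" "0 < n" using D T0 by (auto simp: n_def)
  have h: "0 \<le> h" "n * h = D" using n(2) D by (auto simp: h_def)
  have "h * (4 * sqrt T) \<le> 1"
    using n D by (simp add: h_def field_simps)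
  hence "(h * (4 * sqrt T))\<^sup>2 \<le> 1" using h T0 by (simp add: power_le_one)
  hence hT: "8 * h\<^sup>2 * T \<le> 1" by (simp add: power_mult_distrib)
  define \<nu> where "\<nu> = (\<lambda>m. two_point_bandit \<sigma> (1 / 2 + real m * h))"
  define E where "E = (\<lambda>m. expected_pulls (alg T 2) (\<nu> m) T 0)"
  have mh: "0 \<le> real m * h" "real m * h \<le> D" if "m \<le> n" for m
    using h that mult_right_mono[of "real m" "real n" h] by auto
  have in_class: "\<nu> m \<in> sg_class M \<sigma> Kbar" if "m \<le> n" for m
    unfolding \<nu>_def
  proof (rule two_point_bandit_in_class)
    have "\<sigma> * (2 * (1 / 2 + real m * h) - 1) = 2 * \<sigma> * (real m * h)" by simp
    also have "\<dots> \<le> 2 * \<sigma> * D" using mh[OF that] pos by (intro mult_left_mono) auto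
    also have "\<dots> = 4 * (R / T)" using pos by (simp add: D_def)
    also have "\<dots> \<le> M" using small(1) by linarith
    finally show "\<sigma> * (2 * (1 / 2 + real m * h) - 1) \<le> M" .
  qed (use mh[OF that] D pos in auto)
  have policy2: "is_policy 2 (alg T 2)" using alg(1) by (auto simp: is_algorithm_def)
  have len: "length (\<nu> m) = 2" for m by (simp add: \<nu>_def)
  have E0: "E 0 = T / 2"
  proof -
    interpret bandit_run "\<nu> 0" "alg T 2"
      using bandit_run_algorithm[OF alg(1) in_class[of 0]] len by simp
    have "\<nu> 0 ! 0 = \<nu> 0 ! 1" by (simp add: \<nu>_def two_point_bandit_def)
    hence "expected_pulls (alg T 2) (\<nu> 0) T 0 = expected_pulls (alg T 2) (\<nu> 0) T 1"
      using alg(2) in_class[of 0] len unfolding standing_assumptions_def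
      by (metis one_less_numeral_iff semiring_norm(76) zero_le zero_less_numeral)
    thus ?thesis using sum_expected_pulls[of T] len[of 0]
      by (simp add: E_def numeral_2_eq_2 lessThan_Suc)
  qed
  \<comment> \<open>At the last instance each pull of the first arm costs \<open>4 * R / T\<close>,
    while the total regret is at most \<open>R\<close>.\<close>
  have En: "E n \<le> T / 4"
  proof -
    have "1 / 2 \<le> 1 / 2 + real n * h" "1 / 2 + real n * h \<le> 1" using h D by auto
    note gap = gap_two_point_bandit[OF this pos(2)]
    have "2 * \<sigma> * D * E n = regret alg (\<nu> n) T"
      using gap h(2) by (simp add: regret_def \<nu>_def E_def numeral_2_eq_2 lessThan_Suc)
    also have "\<dots> \<le> R" unfolding R_def by (rule regret_le_worst_regret[OF alg(1) in_class]) simp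
    finally have "4 * (R / T) * E n \<le> R" using pos by (simp add: D_def)
    thus ?thesis using R T0 by (simp add: field_simps)
  qed
  \<comment> \<open>The one-step bound asks for a positive bound on the deviation, and
    \<open>S\<close> is not yet known to be positive. So it is applied with any
    \<open>S' > S\<close>, and \<open>S'\<close> tends to \<open>S\<close> at the end.\<close>
  have step: "\<bar>E (Suc m) - E m\<bar> \<le> 4 * h * sqrt T * S'" if m: "m < n" and S': "S < S'" for m S'
  proof -
    have var: "sqrt (variance_pulls (alg T 2) (\<nu> m) T 0) \<le> S"
    proof -
      have "sqrt (variance_pulls (alg T 2) (\<nu> m) T 0) \<le> variability alg (\<nu> m) T"
        using sqrt_variance_le_variability[of 0 "\<nu> m" alg T] len by simp
      also have "\<dots> \<le> S" unfolding S_def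
        using m by (intro variability_le_worst_variability[OF alg(1) in_class]) auto
      finally show ?thesis .
    qed
    interpret bandit_run "\<nu> m" "alg T 2"
      using bandit_run_algorithm[OF alg(1) in_class[of m]] len m by simp
    have "0 \<le> sqrt (variance_pulls (alg T 2) (\<nu> m) T 0)" using variance_pulls_bounds by simp
    hence "0 < S'" "sqrt (variance_pulls (alg T 2) (\<nu> m) T 0) \<le> S'" using var S' by linarith+
    hence V: "variance_pulls (alg T 2) (\<nu> m) T 0 \<le> S'\<^sup>2" "S' > 0" by (auto simp: sqrt_le_D)
    have "1 / 2 \<le> 1 / 2 + real m * h" "1 / 2 + real m * h + h \<le> 3 / 4"
      using mh[of "Suc m"] mh[of m] m D by (auto simp: algebra_simps)
    from expected_pulls_two_point_step[OF policy2 this h(1) hT pos(2) V[unfolded \<nu>_def]]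
    show ?thesis by (simp add: E_def \<nu>_def algebra_simps)
  qed
  have bound: "\<sigma> / 32 * T powr (3/2) / R \<le> S'" if S': "S < S'" for S'
  proof -
    have "E 0 - E m \<le> m * (4 * h * sqrt T * S')" if "m \<le> n" for m
      using that
    proof (induction m)
      case (Suc m)
      thus ?case using step[of m S'] S' by (auto simp: algebra_simps abs_le_iff)
    qed simp
    from this[of n] have "T / 4 \<le> n * (4 * h * sqrt T * S')" using E0 En by simp
    \<comment> \<open>The one-step bounds are linear in \<open>h\<close>, so only the total shift
      \<open>n * h\<close> survives and the subdivision costs nothing.\<close>
    also have "\<dots> = 4 * (n * h) * sqrt T * S'" by simp
    also have "\<dots> = 4 * D * sqrt T * S'" by (simp only: h(2))
    finally have "T * T \<le> 32 * R / \<sigma> * sqrt T * S'" using T0 pos by (simp add: D_def field_simps)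
    moreover have "real T * T = sqrt T * (T powr (3/2))"
      using T0 by (simp add: powr_half_sqrt[symmetric] flip: powr_add) (simp add: powr_numeral power2_eq_square)
    ultimately have "sqrt T * (T powr (3/2)) \<le> sqrt T * (32 * R / \<sigma> * S')" by (simp add: mult_ac)
    hence "T powr (3/2) \<le> 32 * R / \<sigma> * S'" using T0 by (subst (asm) mult_le_cancel_left_pos) auto
    thus ?thesis using R pos by (simp add: field_simps)
  qed
  have "\<sigma> / 32 * T powr (3/2) / R \<le> S" by (rule dense_ge) (rule bound)
  thus ?thesis using R by (simp add: S_def field_simps)
qed

text \<open>Sublinear regret brings \<open>R / T\<close> below the fixed thresholds that keep the
  shifted instances in the class. The constant is the same for all algorithms; only the time from
  which the bound holds varies.\<close>

lemma active_learning_lower_bound: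
  assumes pos: "M > 0" "\<sigma> > 0" "Kbar \<ge> 2" and al: "active_learning M \<sigma> Kbar alg"
  shows "\<forall>\<^sub>F T in sequentially. \<sigma> / 32 * real T powr (3/2) \<le>
           worst_regret M \<sigma> Kbar alg T * worst_variability M \<sigma> Kbar alg T"
proof -
  have alg: "is_algorithm alg" "standing_assumptions M \<sigma> Kbar alg"
    and lim: "(\<lambda>T. worst_regret M \<sigma> Kbar alg T / real T) \<longlonglongrightarrow> 0"
    using al by (auto simp: active_learning_def)
  have "0 < min (M / 4) (\<sigma> / 8)" using pos by simp
  from order_tendstoD(2)[OF lim this] eventually_ge_at_top[of 2] show ?thesis
  proof eventually_elim
    case (elim T)
    thus ?case by (intro worst_regret_times_variability_ge[OF pos _ alg]) auto
  qed
qed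

subsection \<open>Upper confidence bound policies\<close>

definition pulls :: "(nat \<times> real) list \<Rightarrow> nat \<Rightarrow> nat" where
  "pulls h i = count_list (map fst h) i"

definition total_reward :: "(nat \<times> real) list \<Rightarrow> nat \<Rightarrow> real" where
  "total_reward h i = (\<Sum>(a, r)\<leftarrow>h. if a = i then r else 0)"

text \<open>The usual index with a free bonus factor. A large \<open>b\<close> costs regret, but
  lets the bonus, a function of the pull counts alone, dominate the noise of the empirical
  means.\<close>

definition ucb_index :: "real \<Rightarrow> (nat \<times> real) list \<Rightarrow> nat \<Rightarrow> real" where
  "ucb_index b h i = total_reward h i / pulls h i + b / sqrt (pulls h i)"

text \<open>By the convention \<open>x / 0 = 0\<close> an arm without pulls would have index 0, so
  such arms are served beforehand.\<close>

definition ucb_arms :: "nat \<Rightarrow> real \<Rightarrow> (nat \<times> real) list \<Rightarrow> nat set" where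
  "ucb_arms K b h =
     (if \<exists>i<K. pulls h i = 0 then {i. i < K \<and> pulls h i = 0}
      else {i. i < K \<and> (\<forall>j<K. ucb_index b h j \<le> ucb_index b h i)})"

text \<open>Uniform tie-breaking makes the policy equivariant under relabelling of arms; a fixed
  order could favour one of two arms with equal laws.\<close>

definition ucb :: "nat \<Rightarrow> real \<Rightarrow> policy" where
  "ucb K b h = pmf_of_set (ucb_arms K b h)"

lemma ucb_arms_subset: "ucb_arms K b h \<subseteq> {..<K}"
  by (auto simp: ucb_arms_def)

lemma finite_ucb_arms [simp]: "finite (ucb_arms K b h)"
  using finite_subset[OF ucb_arms_subset] by simp

lemma ucb_arms_nonempty:
  assumes "K \<ge> 1"
  shows "ucb_arms K b h \<noteq> {}"
proof (cases "\<exists>i<K. pulls h i = 0")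
  case False
  have ne: "ucb_index b h ` {..<K} \<noteq> {}" using assms by (auto simp: lessThan_empty_iff)
  have "Max (ucb_index b h ` {..<K}) \<in> ucb_index b h ` {..<K}" using ne by (intro Max_in) auto
  then obtain i where "i < K" "ucb_index b h i = Max (ucb_index b h ` {..<K})" by force
  moreover have "ucb_index b h j \<le> Max (ucb_index b h ` {..<K})" if "j < K" for j
    using that by (intro Max_ge) auto
  ultimately have "i \<in> ucb_arms K b h" using False by (auto simp: ucb_arms_def)
  thus ?thesis by blast
qed (auto simp: ucb_arms_def)

lemma set_pmf_ucb: "K \<ge> 1 \<Longrightarrow> set_pmf (ucb K b h) = ucb_arms K b h"
  unfolding ucb_def by (intro set_pmf_of_set ucb_arms_nonempty finite_ucb_arms)

text \<open>The cardinality is written as a sum of indicators so that measurability in the rewards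
  can be checked termwise.\<close>

lemma pmf_ucb:
  assumes "K \<ge> 1"
  shows "pmf (ucb K b h) a = (if a \<in> ucb_arms K b h then 1 else 0) /
           (\<Sum>i<K. if i \<in> ucb_arms K b h then 1 else 0)"
proof -
  have "real (card (ucb_arms K b h)) = (\<Sum>i<K. if i \<in> ucb_arms K b h then 1 else 0)"
    using ucb_arms_subset[of K b h] by (simp add: sum.If_cases Int_absorb1)
  thus ?thesis unfolding ucb_def
    using assms ucb_arms_nonempty by (subst pmf_of_set) (auto simp: indicator_def)
qed

text \<open>For fixed actions the pull counts are constants, so the branch taken in
  \<open>ucb_arms\<close> is fixed. The indices are affine in the rewards, and the chosen set is
  given by finitely many comparisons of them.\<close>

lemma is_policy_ucb:
  assumes K: "K \<ge> 1"
  shows "is_policy K (ucb K b)"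
  unfolding is_policy_def
proof (intro conjI allI impI)
  show "set_pmf (ucb K b h) \<subseteq> {..<K}" for h
    using set_pmf_ucb[OF K] ucb_arms_subset by blast
  fix as :: "nat list" and a assume as: "set as \<subseteq> {..<K}"
  define h where "h = (\<lambda>r :: nat \<Rightarrow> real. zip as (map r [0..<length as]))"
  define P where "P = (\<Pi>\<^sub>M t\<in>{..<length as}. (borel :: real measure))"
  have pulls: "pulls (h r) i = count_list as i" for r i
    by (simp add: pulls_def h_def)
  have "total_reward (h r) i = (\<Sum>t<length as. if as ! t = i then r t else 0)" for r i
    unfolding total_reward_def sum_list_sum_nth
    by (rule sum.cong) (auto simp: h_def)
  moreover have "(\<lambda>r. if as ! t = i then r t else 0) \<in> borel_measurable P" if "t < length as" for t i
    using that unfolding P_def by (cases "as ! t = i") (auto intro!: measurable_component_singleton)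
  ultimately have "(\<lambda>r. total_reward (h r) i) \<in> borel_measurable P" for i
    by (auto intro!: borel_measurable_sum)
  hence idx_meas: "(\<lambda>r. ucb_index b (h r) i) \<in> borel_measurable P" for i
    unfolding ucb_index_def pulls
    by (rule borel_measurable_add[OF borel_measurable_divide[OF _ measurable_const] measurable_const]) auto
  have arms_meas: "Measurable.pred P (\<lambda>r. i \<in> ucb_arms K b (h r))" for i
  proof (cases "(\<exists>i<K. count_list as i = 0) \<or> \<not> i < K")
    case False
    have "Measurable.pred P (\<lambda>r. \<forall>j\<in>{..<K}. ucb_index b (h r) j \<le> ucb_index b (h r) i)"
      unfolding pred_def by (intro sets.sets_Collect_finite_All borel_measurable_le idx_meas) auto
    moreover have "i \<in> ucb_arms K b (h r) \<longleftrightarrow> (\<forall>j\<in>{..<K}. ucb_index b (h r) j \<le> ucb_index b (h r) i)" for r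
      using False by (auto simp: ucb_arms_def pulls)
    ultimately show ?thesis by simp
  next
    case True
    hence "i \<in> ucb_arms K b (h r) \<longleftrightarrow> i < K \<and> count_list as i = 0" for r
      by (auto simp: ucb_arms_def pulls)
    thus ?thesis by simp
  qed
  have "(\<lambda>r. pmf (ucb K b (h r)) a) \<in> borel_measurable P"
    unfolding pmf_ucb[OF K]
    by (intro borel_measurable_divide borel_measurable_sum measurable_If predE[OF arms_meas]) auto
  thus "(\<lambda>r. pmf (ucb K b (zip as (map r [0..<length as]))) a)
          \<in> borel_measurable (\<Pi>\<^sub>M t\<in>{..<length as}. (borel :: real measure))"
    by (simp only: h_def P_def)
qed

section \<open>Equivariance under relabelling of arms\<close>

lemma count_list_map_inj: "inj \<tau> \<Longrightarrow> count_list (map \<tau> as) (\<tau> i) = count_list as i"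
  by (induction as) (auto simp: inj_eq)

lemma total_reward_map_inj:
  "inj \<tau> \<Longrightarrow> total_reward (map (map_prod \<tau> id) h) (\<tau> i) = total_reward h i"
  by (induction h) (auto simp: total_reward_def inj_eq)

lemma ucb_permute:
  assumes \<tau>: "inj \<tau>" "\<tau> ` {..<K} = {..<K}" and K: "K \<ge> 1"
  shows "ucb K b (map (map_prod \<tau> id) h) = map_pmf \<tau> (ucb K b h)"
proof -
  define h' where "h' = map (map_prod \<tau> id) h"
  have "map fst h' = map \<tau> (map fst h)" by (simp add: h'_def)
  hence pulls: "pulls h' (\<tau> i) = pulls h i" for i
    by (simp only: pulls_def count_list_map_inj[OF \<tau>(1)])
  have index: "ucb_index b h' (\<tau> i) = ucb_index b h i" for i
    by (simp add: ucb_index_def pulls total_reward_map_inj[OF \<tau>(1)] h'_def[symmetric])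
      (simp add: h'_def total_reward_map_inj[OF \<tau>(1)])
  have all: "(\<forall>j<K. P j) \<longleftrightarrow> (\<forall>j<K. P (\<tau> j))" for P
    using \<tau>(2) by (metis (no_types, lifting) imageE imageI lessThan_iff)
  have lt: "\<tau> i < K \<longleftrightarrow> i < K" for i
    using \<tau> by (metis image_eqI inj_image_mem_iff lessThan_iff)
  have mem: "\<tau> i \<in> ucb_arms K b h' \<longleftrightarrow> i \<in> ucb_arms K b h" for i
    using all[of "\<lambda>j. pulls h' j \<noteq> 0"] all[of "\<lambda>j. ucb_index b h' j \<le> ucb_index b h i"]
    unfolding ucb_arms_def by (auto simp: pulls index lt)
  have "ucb_arms K b h' = \<tau> ` ucb_arms K b h"
  proof (intro equalityI subsetI)
    fix a assume a: "a \<in> ucb_arms K b h'"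
    then obtain i where "a = \<tau> i" using ucb_arms_subset[of K b h'] \<tau>(2) by blast
    thus "a \<in> \<tau> ` ucb_arms K b h" using a mem by blast
  qed (use mem in blast)
  thus ?thesis unfolding ucb_def h'_def[symmetric]
    using \<tau>(1) K by (subst map_pmf_of_set_inj) (auto simp: ucb_arms_nonempty inj_on_def inj_def)
qed

text \<open>By equivariance, playing on the table with permuted rows and then relabelling the
  actions is the same as playing on the original table.\<close>

lemma actions_permute:
  assumes \<tau>: "inj \<tau>"
    and eq: "\<And>h. \<pi> (map (map_prod \<tau> id) h) = map_pmf \<tau> (\<pi> h)"
  shows "actions \<pi> x t = map_pmf (map \<tau>) (actions \<pi> (\<lambda>p. x (\<tau> (fst p), snd p)) t)"
proof (induction t)
  case (Suc t)
  have "history x (map \<tau> as) = map (map_prod \<tau> id) (history (\<lambda>p. x (\<tau> (fst p), snd p)) as)" for as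
    by (auto simp: history_def take_map count_list_map_inj[OF \<tau>])
  thus ?case by (simp add: Suc.IH eq map_bind_pmf bind_map_pmf pmf.map_comp o_def)
qed simp

text \<open>Permuting rows of equal law preserves the law of the table, while it turns the pulls of
  \<open>\<tau> i\<close> into those of \<open>i\<close>.\<close>

lemma (in bandit_run) expected_pulls_permute:
  assumes \<tau>: "inj \<tau>" "\<tau> ` {..<K} = {..<K}"
    and eq: "\<And>h. \<pi> (map (map_prod \<tau> id) h) = map_pmf \<tau> (\<pi> h)"
    and laws: "\<And>i. i < K \<Longrightarrow> \<nu> ! \<tau> i = \<nu> ! i"
  shows "expected_pulls \<pi> \<nu> t (\<tau> i) = expected_pulls \<pi> \<nu> t i"
proof -
  define I where "I = {..<K} \<times> {1::nat..}"
  define f where "f = map_prod \<tau> (id :: nat \<Rightarrow> nat)"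
  define r where "r = (\<lambda>x :: nat \<times> nat \<Rightarrow> real. \<lambda>p\<in>I. x (f p))"
  define g where "g = (\<lambda>x. \<integral>as. real (count_list as i) \<partial>actions \<pi> x t)"
  have fI: "f \<in> I \<rightarrow> I" using \<tau>(2) by (auto simp: f_def I_def)
  have "total_law (f p) = total_law p" if "p \<in> I" for p
    using that fI laws by (auto simp: total_law_def f_def I_def Pi_iff)
  hence PiM_f: "(\<Pi>\<^sub>M p\<in>I. total_law (f p)) = PiM I total_law" by (intro PiM_cong) auto
  have distr: "distr (PiM I total_law) (PiM I total_law) r = PiM I total_law"
  proof -
    have "inj_on f I" using \<tau>(1) unfolding f_def by (intro inj_on_subset[OF prod.inj_map]) auto
    from distr_PiM_reindex[of I total_law f I, OF prob_space_total_law this fI] show ?thesis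
      by (simp add: PiM_f r_def)
  qed
  have r: "r \<in> measurable (PiM I total_law) (PiM I total_law)"
    unfolding r_def
  proof (rule measurable_restrict)
    fix p assume p: "p \<in> I"
    hence "f p \<in> I" using fI by blast
    hence "(\<lambda>x. x (f p)) \<in> measurable (PiM I total_law) (total_law (f p))"
      by (rule measurable_component_singleton)
    thus "(\<lambda>x. x (f p)) \<in> measurable (PiM I total_law) (total_law p)"
      by (subst measurable_cong_sets[OF refl, of _ "total_law (f p)"]) auto
  qed
  have "(\<integral>as. real (count_list as (\<tau> i)) \<partial>actions \<pi> x t) = g (r x)" for x
  proof -
    have "actions \<pi> (\<lambda>p. x (\<tau> (fst p), snd p)) t = actions \<pi> (r x) t"
      by (rule actions_cong[OF set_pmf_policy]) (auto simp: r_def I_def f_def)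
    hence "actions \<pi> x t = map_pmf (map \<tau>) (actions \<pi> (r x) t)"
      using actions_permute[where \<tau> = \<tau> and \<pi> = \<pi> and x = x, OF \<tau>(1) eq] by simp
    thus ?thesis by (simp add: g_def count_list_map_inj[OF \<tau>(1)])
  qed
  hence "expected_pulls \<pi> \<nu> t (\<tau> i) = (\<integral>x. g (r x) \<partial>PiM I total_law)"
    by (simp add: expected_pulls_eq reward_table_eq I_def)
  also have "\<dots> = (\<integral>x. g x \<partial>distr (PiM I total_law) (PiM I total_law) r)"
    using measurable_integral_actions
    by (intro integral_distr[symmetric] r) (simp add: g_def reward_table_eq I_def)
  also have "\<dots> = expected_pulls \<pi> \<nu> t i"
    unfolding distr by (simp add: g_def expected_pulls_eq reward_table_eq I_def)
  finally show ?thesis .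
qed

section \<open>Properties of single UCB runs\<close>

lemma history_snoc:
  "history x (as @ [a]) = history x as @ [(a, x (a, Suc (count_list as a)))]"
  unfolding history_def by (auto simp: nth_append)

lemma pulls_history: "pulls (history x as) i = count_list as i"
  by (induction as rule: rev_induct) (auto simp: history_snoc pulls_def history_def[of x "[]"])

lemma total_reward_history:
  "total_reward (history x as) i = (\<Sum>s=1..count_list as i. x (i, s))"
  by (induction as rule: rev_induct)
    (auto simp: history_snoc total_reward_def history_def[of x "[]"])

text \<open>While \<open>j\<close> is unpulled only unpulled arms are chosen. The run would then
  consist of \<open>T \<ge> K\<close> distinct arms other than \<open>j\<close>.\<close>

lemma ucb_pulls_every_arm:
  assumes K: "K \<ge> 1" and as: "as \<in> set_pmf (actions (ucb K b) x T)" and T: "T \<ge> K" and j: "j < K"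
  shows "count_list as j \<ge> 1"
proof (rule ccontr)
  assume "\<not> count_list as j \<ge> 1"
  hence j0: "j \<notin> set as" by (simp add: count_list_0_iff not_less_eq_eq)
  have arms: "as ! s \<in> ucb_arms K b (history x (take s as))" if "s < T" for s
    using set_pmf_actions[OF as] that set_pmf_ucb[OF K] by auto
  have len: "length as = T" using set_pmf_actions[OF as] by simp
  have "as ! s \<notin> set (take s as)" if "s < T" for s
  proof -
    have "j \<notin> set (take s as)" using j0 by (meson in_set_takeD)
    hence "\<exists>i<K. pulls (history x (take s as)) i = 0"
      using j by (auto simp: pulls_history count_list_0_iff)
    thus ?thesis using arms[OF that] by (simp add: ucb_arms_def pulls_history count_list_0_iff)
  qed
  hence "distinct as"
    unfolding distinct_conv_nth len
    by (metis in_set_conv_nth length_take len linorder_neqE_nat min.absorb4 nth_take)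
  hence "card (set as) = T" by (simp add: distinct_card len)
  moreover have "set as \<subseteq> {..<K} - {j}"
    using j0 arms ucb_arms_subset by (fastforce simp: in_set_conv_nth len)
  hence "card (set as) \<le> card ({..<K} - {j})" by (intro card_mono) auto
  ultimately show False using T j by simp
qed

text \<open>The inequality compares the indices just before the last pull of \<open>i\<close>, when
  \<open>i\<close> has one pull less than at the end and \<open>j\<close> has some \<open>n\<close>.
  At least two pulls of \<open>i\<close> ensure that this pull was decided by the indices and not by
  the initial round.\<close>

lemma ucb_last_pull:
  assumes K: "K \<ge> 1" and as: "as \<in> set_pmf (actions (ucb K b) x T)"
    and i: "count_list as i \<ge> 2" and j: "j < K"
  defines "m \<equiv> (\<lambda>k n. (\<Sum>s=1..n. x (k, s)) / real n)"
  obtains n where "1 \<le> n" "n \<le> count_list as j"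
    "m j n + b / sqrt n \<le> m i (count_list as i - 1) + b / sqrt (count_list as i - 1)"
proof -
  have "i \<in> set as" using i by (metis count_list_0_iff not_numeral_le_zero)
  then obtain ys zs where split: "as = ys @ i # zs" "i \<notin> set zs" by (metis split_list_last)
  have len: "length as = T" using set_pmf_actions[OF as] by simp
  have "as ! length ys \<in> set_pmf (ucb K b (history x (take (length ys) as)))"
    using conjunct2[OF set_pmf_actions[OF as], rule_format, of "length ys"] split(1) len by simp
  hence arm: "i \<in> ucb_arms K b (history x ys)" unfolding split(1) by (simp add: set_pmf_ucb[OF K])
  have ci: "count_list ys i = count_list as i - 1" "count_list ys i \<ge> 1"
    using split i by (auto simp: count_notin)
  hence nz: "\<not> (\<exists>k<K. pulls (history x ys) k = 0)"
    using arm by (auto simp: ucb_arms_def pulls_history split: if_splits)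
  have idx: "ucb_index b (history x ys) k = m k (count_list ys k) + b / sqrt (count_list ys k)" for k
    by (simp add: ucb_index_def pulls_history total_reward_history m_def)
  have "ucb_index b (history x ys) j \<le> ucb_index b (history x ys) i"
    using arm nz j by (auto simp: ucb_arms_def)
  hence "m j (count_list ys j) + b / sqrt (count_list ys j) \<le>
     m i (count_list as i - 1) + b / sqrt (count_list as i - 1)"
    using ci by (simp add: idx of_nat_diff)
  moreover have "1 \<le> count_list ys j" using nz j by (auto simp: pulls_history Suc_le_eq)
  moreover have "count_list ys j \<le> count_list as j" using split by simp
  ultimately show ?thesis using that by blast
qed

subsection \<open>Concentration and stability\<close>

text \<open>Chernoff's bound; the sign \<open>u\<close> treats both tails at once.\<close>

lemma (in bandit_run) sub_gaussian_deviation_one_sided: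
  assumes i: "i < K" and n: "n \<ge> 1" and sg: "sub_gaussian \<sigma> (\<nu> ! i)" and "\<sigma> > 0" "\<epsilon> > 0"
    and u: "u = 1 \<or> u = (-1 :: real)"
  shows "P.prob {x \<in> space (reward_table \<nu>). u * ((\<Sum>s=1..n. x (i, s)) - n * mean (\<nu> ! i)) \<ge> \<epsilon>}
           \<le> exp (- (\<epsilon>\<^sup>2 / (2 * n * \<sigma>\<^sup>2)))"
proof -
  define \<mu> where "\<mu> = mean (\<nu> ! i)"
  \<comment> \<open>The minimiser of the exponent
    \<open>- l * \<epsilon> + n * l^2 * \<sigma>^2 / 2\<close>.\<close>
  define l where "l = \<epsilon> / (n * \<sigma>\<^sup>2)"
  have l: "l > 0" using n assms by (simp add: l_def)
  define J where "J = {i} \<times> {1..n}"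
  have J: "finite J" "J \<subseteq> {..<K} \<times> {1..}" using i by (auto simp: J_def)
  define dev where "dev = (\<lambda>x :: nat \<times> nat \<Rightarrow> real. u * ((\<Sum>s=1..n. x (i, s)) - n * \<mu>))"
  have law: "total_law p = \<nu> ! i" if "p \<in> J" for p using that i by (auto simp: J_def total_law_def)
  have int: "integrable (total_law p) (\<lambda>y. exp (l * u * (y - \<mu>)))" if "p \<in> J" for p
    using sg unfolding law[OF that] sub_gaussian_def \<mu>_def by blast
  have exp_eq: "exp (l * dev x) = (\<Prod>p\<in>J. exp (l * u * (x p - \<mu>)))" for x
  proof -
    have "l * dev x = (\<Sum>s=1..n. l * u * (x (i, s) - \<mu>))"
      by (simp add: dev_def sum_subtractf flip: sum_distrib_left)
    also have "\<dots> = (\<Sum>p\<in>J. l * u * (x p - \<mu>))"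
    proof -
      have "J = Pair i ` {1..n}" by (auto simp: J_def)
      thus ?thesis by (simp add: sum.reindex inj_on_def)
    qed
    finally show ?thesis by (simp add: exp_sum J(1))
  qed
  have int_exp: "integrable (reward_table \<nu>) (\<lambda>x. exp (l * dev x))"
    unfolding exp_eq reward_table_eq using J int by (rule table.integrable_prod_components)
  have "P.prob {x \<in> space (reward_table \<nu>). dev x \<ge> \<epsilon>} \<le>
        exp (- l * \<epsilon>) * (\<integral>x\<in>space (reward_table \<nu>). exp (l * dev x) \<partial>reward_table \<nu>)"
    using integrable_mult_indicator[OF sets.top int_exp]
    by (intro P.Chernoff_ineq_ge l) (auto simp: set_integrable_def)
  also have "(\<integral>x\<in>space (reward_table \<nu>). exp (l * dev x) \<partial>reward_table \<nu>) =
        (\<integral>x. exp (l * dev x) \<partial>reward_table \<nu>)"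
    using int_exp by (rule set_integral_space)
  also have "\<dots> = (\<Prod>p\<in>J. \<integral>y. exp (l * u * (y - \<mu>)) \<partial>total_law p)"
    unfolding exp_eq reward_table_eq using J int by (rule table.integral_prod_components)
  also have "\<dots> \<le> (\<Prod>p\<in>J. exp (l\<^sup>2 * \<sigma>\<^sup>2 / 2))"
  proof (rule prod_mono, intro conjI)
    fix p assume p: "p \<in> J"
    show "0 \<le> (\<integral>y. exp (l * u * (y - \<mu>)) \<partial>total_law p)" by (rule integral_nonneg_AE) auto
    have "(\<integral>y. exp (l * u * (y - \<mu>)) \<partial>total_law p) \<le> exp ((l * u)\<^sup>2 * \<sigma>\<^sup>2 / 2)"
      using sg unfolding law[OF p] sub_gaussian_def \<mu>_def by blast
    thus "(\<integral>y. exp (l * u * (y - \<mu>)) \<partial>total_law p) \<le> exp (l\<^sup>2 * \<sigma>\<^sup>2 / 2)"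
      using u by (auto simp: power_mult_distrib)
  qed
  also have "\<dots> = exp (n * (l\<^sup>2 * \<sigma>\<^sup>2 / 2))"
    by (simp add: J_def flip: exp_of_nat_mult)
  also have "exp (- l * \<epsilon>) * exp (n * (l\<^sup>2 * \<sigma>\<^sup>2 / 2)) = exp (- (\<epsilon>\<^sup>2 / (2 * n * \<sigma>\<^sup>2)))"
    unfolding exp_add[symmetric] using n assms by (simp add: l_def field_simps power2_eq_square)
  finally show ?thesis by (simp add: dev_def \<mu>_def)
qed

context bandit_run
begin

text \<open>The event concerns partial sums of fixed length in the table and not the policy, so a
  union bound over \<open>n\<close> replaces a martingale argument for random pull counts.\<close>

definition concentrated :: "real \<Rightarrow> nat \<Rightarrow> (nat \<times> nat \<Rightarrow> real) set" where
  "concentrated \<beta> T = {x \<in> space (reward_table \<nu>).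
     \<forall>i<K. \<forall>n\<in>{1..T}. \<bar>(\<Sum>s=1..n. x (i, s)) - n * mean (\<nu> ! i)\<bar> < \<beta> * sqrt n}"

text \<open>Union bound over arms, lengths and signs. Deviations of size
  \<open>\<beta> * sqrt n\<close> have the same tail bound for every \<open>n\<close>.\<close>

lemma prob_not_concentrated:
  assumes sg: "\<And>i. i < K \<Longrightarrow> sub_gaussian \<sigma> (\<nu> ! i)" and pos: "\<sigma> > 0" "\<beta> > 0"
  shows "space (reward_table \<nu>) - concentrated \<beta> T \<in> P.events"
    and "P.prob (space (reward_table \<nu>) - concentrated \<beta> T) \<le> 2 * K * T * exp (- (\<beta>\<^sup>2 / (2 * \<sigma>\<^sup>2)))"
proof -
  define dev where "dev = (\<lambda>i n x. (\<Sum>s=1..n. x (i, s)) - real n * mean (\<nu> ! i))"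
  define A where "A = (\<lambda>p. {x \<in> space (reward_table \<nu>). 1 * dev (fst p) (snd p) x \<ge> \<beta> * sqrt (snd p)} \<union>
      {x \<in> space (reward_table \<nu>). - 1 * dev (fst p) (snd p) x \<ge> \<beta> * sqrt (snd p)})"
  have dev: "dev i n \<in> borel_measurable (reward_table \<nu>)" if "i < K" for i n
    unfolding dev_def using that measurable_table_component[of i]
    by (intro borel_measurable_diff borel_measurable_sum borel_measurable_const) auto
  have sets: "{x \<in> space (reward_table \<nu>). u * dev i n x \<ge> e} \<in> P.events" if "i < K" for i n u e
    using dev[OF that] by (intro borel_measurable_le borel_measurable_const borel_measurable_times)
  have mem_A: "x \<in> A p \<longleftrightarrow> x \<in> space (reward_table \<nu>) \<and> \<not> \<bar>dev (fst p) (snd p) x\<bar> < \<beta> * sqrt (snd p)" for x p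
    by (auto simp: A_def abs_less_iff not_less)
  have Un: "space (reward_table \<nu>) - concentrated \<beta> T = (\<Union>p\<in>{..<K} \<times> {1..T}. A p)"
  proof (rule set_eqI)
    fix x
    have "x \<in> space (reward_table \<nu>) - concentrated \<beta> T \<longleftrightarrow>
        x \<in> space (reward_table \<nu>) \<and> (\<exists>i<K. \<exists>n\<in>{1..T}. \<not> \<bar>dev i n x\<bar> < \<beta> * sqrt n)"
      unfolding concentrated_def dev_def by blast
    also have "\<dots> \<longleftrightarrow> x \<in> (\<Union>p\<in>{..<K} \<times> {1..T}. A p)"
      by (auto simp: mem_A)
    finally show "x \<in> space (reward_table \<nu>) - concentrated \<beta> T \<longleftrightarrow>
        x \<in> (\<Union>p\<in>{..<K} \<times> {1..T}. A p)" .
  qed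
  have A: "A p \<in> P.events" if "p \<in> {..<K} \<times> {1..T}" for p
    using that unfolding A_def by (intro sets.Un sets) auto
  show "space (reward_table \<nu>) - concentrated \<beta> T \<in> P.events"
    unfolding Un using A by (intro sets.finite_UN) auto
  have "P.prob (A p) \<le> 2 * exp (- (\<beta>\<^sup>2 / (2 * \<sigma>\<^sup>2)))" if p: "p \<in> {..<K} \<times> {1..T}" for p
  proof -
    have *: "P.prob {x \<in> space (reward_table \<nu>). u * dev (fst p) (snd p) x \<ge> \<beta> * sqrt (snd p)}
          \<le> exp (- (\<beta>\<^sup>2 / (2 * \<sigma>\<^sup>2)))" if u: "u = 1 \<or> u = - 1" for u
    proof -
      have "P.prob {x \<in> space (reward_table \<nu>). u * dev (fst p) (snd p) x \<ge> \<beta> * sqrt (snd p)}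
            \<le> exp (- ((\<beta> * sqrt (snd p))\<^sup>2 / (2 * real (snd p) * \<sigma>\<^sup>2)))"
        unfolding dev_def using p pos sg u by (intro sub_gaussian_deviation_one_sided) auto
      also have "(\<beta> * sqrt (snd p))\<^sup>2 / (2 * real (snd p) * \<sigma>\<^sup>2) = \<beta>\<^sup>2 / (2 * \<sigma>\<^sup>2)"
        using p by (auto simp: power_mult_distrib)
      finally show ?thesis .
    qed
    have "P.prob (A p) \<le> P.prob {x \<in> space (reward_table \<nu>). 1 * dev (fst p) (snd p) x \<ge> \<beta> * sqrt (snd p)} +
       P.prob {x \<in> space (reward_table \<nu>). - 1 * dev (fst p) (snd p) x \<ge> \<beta> * sqrt (snd p)}"
      unfolding A_def using p by (intro measure_Un_le sets) auto
    also have "\<dots> \<le> 2 * exp (- (\<beta>\<^sup>2 / (2 * \<sigma>\<^sup>2)))" using *[of 1] *[of "- 1"] by simp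
    finally show ?thesis .
  qed
  hence "P.prob (\<Union>p\<in>{..<K} \<times> {1..T}. A p) \<le> (\<Sum>p\<in>{..<K} \<times> {1..T}. 2 * exp (- (\<beta>\<^sup>2 / (2 * \<sigma>\<^sup>2))))"
    using A by (intro order.trans[OF measure_UNION_le] sum_mono) auto
  thus "P.prob (space (reward_table \<nu>) - concentrated \<beta> T) \<le> 2 * K * T * exp (- (\<beta>\<^sup>2 / (2 * \<sigma>\<^sup>2)))"
    unfolding Un by simp
qed

lemma integral_action_law_le_concentrated:
  assumes sg: "\<And>i. i < K \<Longrightarrow> sub_gaussian \<sigma> (\<nu> ! i)" and pos: "\<sigma> > 0" "\<beta> > 0"
    and good: "\<And>x as. x \<in> concentrated \<beta> T \<Longrightarrow> as \<in> set_pmf (actions \<pi> x t) \<Longrightarrow> F as \<le> a"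
    and all: "\<And>as. as \<in> pull_lists K t \<Longrightarrow> F as \<le> b" and ab: "0 \<le> a" "0 \<le> b"
  shows "(\<integral>as. F as \<partial>action_law \<pi> \<nu> t) \<le> a + b * (2 * K * T * exp (- (\<beta>\<^sup>2 / (2 * \<sigma>\<^sup>2))))"
proof -
  let ?B = "space (reward_table \<nu>) - concentrated \<beta> T"
  note B = prob_not_concentrated[OF sg pos, of T]
  have intB: "integrable (reward_table \<nu>) (indicator ?B :: _ \<Rightarrow> real)"
    using B(1) by (intro integrable_real_indicator) (auto simp: P.emeasure_eq_measure)
  have "(\<integral>as. F as \<partial>action_law \<pi> \<nu> t) \<le> (\<integral>x. a + b * indicator ?B x \<partial>reward_table \<nu>)"
    unfolding integral_action_law
  proof (rule Bochner_Integration.integral_mono[OF integrable_integral_actions])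
    show "integrable (reward_table \<nu>) (\<lambda>x. a + b * indicator ?B x)" using intB by simp
    fix x assume x: "x \<in> space (reward_table \<nu>)"
    have fin: "finite (set_pmf (actions \<pi> x t))" using finite_subset[OF actions_in_pull_lists] by simp
    show "(\<integral>as. F as \<partial>actions \<pi> x t) \<le> a + b * indicator ?B x"
    proof (rule measure_pmf.integral_le_const)
      have "F as \<le> a + b * indicator ?B x" if "as \<in> set_pmf (actions \<pi> x t)" for as
        using good[OF _ that] all[of as] that actions_in_pull_lists x ab
        by (cases "x \<in> concentrated \<beta> T") (auto simp: subset_eq intro: add_increasing)
      thus "AE as in actions \<pi> x t. F as \<le> a + b * indicator ?B x" by (simp add: AE_measure_pmf_iff)
    qed (rule integrable_measure_pmf_finite[OF fin])
  qed
  also have "\<dots> = a + b * P.prob ?B"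
  proof -
    have "(\<integral>x. a + b * indicator ?B x \<partial>reward_table \<nu>) = a + b * (\<integral>x. indicator ?B x \<partial>reward_table \<nu>)"
      using intB P.prob_space by simp
    thus ?thesis using sets.sets_into_space[OF B(1)] by (simp add: Int_absorb2)
  qed
  also have "\<dots> \<le> a + b * (2 * K * T * exp (- (\<beta>\<^sup>2 / (2 * \<sigma>\<^sup>2))))"
    using B(2) ab by (intro add_left_mono mult_left_mono) auto
  finally show ?thesis .
qed

text \<open>The mean minimises the mean squared deviation, so the variance can be bounded about any
  convenient centre.\<close>

lemma variance_pulls_le:
  "variance_pulls \<pi> \<nu> t i \<le> (\<integral>as. (real (count_list as i) - c)\<^sup>2 \<partial>action_law \<pi> \<nu> t)"
proof -
  define E where "E = expected_pulls \<pi> \<nu> t i"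
  define N where "N = (\<lambda>x. \<integral>as. real (count_list as i) \<partial>actions \<pi> x t)"
  define N2 where "N2 = (\<lambda>x. \<integral>as. (real (count_list as i))\<^sup>2 \<partial>actions \<pi> x t)"
  have int: "integrable (reward_table \<nu>) N" "integrable (reward_table \<nu>) N2"
    unfolding N_def N2_def by (rule integrable_integral_actions)+
  have eq: "(\<integral>as. (real (count_list as i) - d)\<^sup>2 \<partial>action_law \<pi> \<nu> t) =
        (\<integral>x. N2 x \<partial>reward_table \<nu>) - 2 * d * E + d\<^sup>2" for d
  proof -
    have "(\<integral>as. (real (count_list as i) - d)\<^sup>2 \<partial>actions \<pi> x t) = N2 x - 2 * d * N x + d\<^sup>2" for x
    proof -
      have fin: "finite (set_pmf (actions \<pi> x t))" using finite_subset[OF actions_in_pull_lists] by simp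
      have "(\<integral>as. (real (count_list as i) - d)\<^sup>2 \<partial>actions \<pi> x t) =
        (\<integral>as. (real (count_list as i))\<^sup>2 - 2 * d * real (count_list as i) + d\<^sup>2 \<partial>actions \<pi> x t)"
        by (simp add: power2_diff algebra_simps)
      also have "\<dots> = N2 x - 2 * d * N x + d\<^sup>2"
      proof -
        have "integrable (actions \<pi> x t) f" for f :: "nat list \<Rightarrow> real"
          using fin by (rule integrable_measure_pmf_finite)
        thus ?thesis by (simp add: N_def N2_def)
      qed
      finally show ?thesis .
    qed
    thus ?thesis unfolding integral_action_law E_def expected_pulls_eq N_def[symmetric]
      using int P.prob_space by simp
  qed
  have "0 \<le> (c - E)\<^sup>2" by simp
  thus ?thesis unfolding variance_pulls_def E_def[symmetric] eq
    by (simp add: power2_diff power2_eq_square algebra_simps)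
qed

end

text \<open>In terms of \<open>p = sqrt u\<close> and \<open>q = sqrt U\<close> the claim is
  \<open>\<beta> * (p + q) < b * (q - p)\<close>. After multiplication by \<open>p + q\<close> it
  follows from \<open>(p + q)^2 \<le> 4 * T\<close> and
  \<open>(q - p) * (p + q) = U - u\<close>.\<close>

lemma ucb_index_separation:
  fixes b \<beta> u U :: real
  assumes "0 < u" "u < U" "U \<le> T" "0 < b" "0 \<le> \<beta>" and far: "4 * \<beta> * T < b * (U - u)"
  shows "(b + \<beta>) / sqrt U < (b - \<beta>) / sqrt u"
proof -
  define p where "p = sqrt u"
  define q where "q = sqrt U"
  have pq: "0 < p" "p < q" "u = p\<^sup>2" "U = q\<^sup>2" using assms by (auto simp: p_def q_def)
  have "(p + q)\<^sup>2 \<le> (2 * q)\<^sup>2" using pq by (intro power_mono) auto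
  hence "\<beta> * (p + q)\<^sup>2 \<le> \<beta> * (4 * T)" using assms pq by (intro mult_left_mono) auto
  also have "\<dots> < b * (q - p) * (p + q)" using far pq by (simp add: power2_eq_square algebra_simps)
  finally have "\<beta> * (p + q) * (p + q) < b * (q - p) * (p + q)" by (simp add: power2_eq_square mult.assoc)
  hence "\<beta> * (p + q) < b * (q - p)" using pq by simp
  hence "(b + \<beta>) * p < (b - \<beta>) * q" by (simp add: algebra_simps)
  thus ?thesis using pq unfolding p_def[symmetric] q_def[symmetric] by (simp add: field_simps)
qed

text \<open>
  The final pull counts \<open>N\<close> of UCB with bonus \<open>b / sqrt n\<close> on a table whose empirical means
  are \<open>\<beta> / sqrt n\<close>-close to the means \<open>\<mu>\<close>: an arm was last pulled when its index was maximal.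
\<close>

definition balanced :: "nat \<Rightarrow> real \<Rightarrow> real \<Rightarrow> (nat \<Rightarrow> real) \<Rightarrow> (nat \<Rightarrow> nat) \<Rightarrow> bool" where
  "balanced K b \<beta> \<mu> N \<longleftrightarrow> (\<forall>i<K. 1 \<le> N i) \<and>
     (\<forall>i<K. \<forall>j<K. 2 \<le> N i \<longrightarrow>
        \<mu> j + (b - \<beta>) / sqrt (N j) \<le> \<mu> i + (b + \<beta>) / sqrt (N i - 1))"

text \<open>
  If one arm has many more pulls under \<open>N\<close> than under \<open>N'\<close>, another arm has many fewer. Adding
  the two balance inequalities for this pair eliminates the means.
\<close>

lemma balanced_stable:
  fixes T :: nat and b \<beta> :: real
  assumes N: "balanced K b \<beta> \<mu> N" "(\<Sum>i<K. N i) = T" and N': "balanced K b \<beta> \<mu> N'" "(\<Sum>i<K. N' i) = T"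
    and b: "0 < b" "0 \<le> \<beta>" and i: "i < K"
  shows "real (N i) - real (N' i) \<le> K * (4 * \<beta> * T / b + 1)"
proof (rule ccontr)
  assume contr: "\<not> ?thesis"
  \<comment> \<open>The separation threshold \<open>4 * \<beta> * T / b\<close>, plus one for the
    pull that is subtracted in \<open>N i - 1\<close>.\<close>
  define W where "W = 4 * \<beta> * T / b + 1"
  have W: "W \<ge> 1" using b by (simp add: W_def)
  have KW: "K * W < real (N i) - real (N' i)" using contr by (simp add: W_def)
  have "1 * W \<le> K * W" using i W by (intro mult_right_mono) auto
  hence Wi: "W < real (N i) - real (N' i)" using KW by simp
  \<comment> \<open>The differences of the counts sum to 0, and a surplus above \<open>K * W\<close>
    at \<open>i\<close> cannot be offset by deficits of at most \<open>W\<close> at the other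
    arms.\<close>
  have "\<exists>j<K. W < real (N' j) - real (N j)"
  proof (rule ccontr)
    assume "\<not> ?thesis"
    hence le: "real (N' j) - real (N j) \<le> W" if "j < K" for j using that by force
    have "0 = (\<Sum>j<K. real (N' j) - real (N j))"
      using N(2) N'(2) by (simp add: sum_subtractf flip: of_nat_sum)
    also have "\<dots> = (real (N' i) - real (N i)) + (\<Sum>j\<in>{..<K} - {i}. real (N' j) - real (N j))"
      using i by (intro sum.remove) auto
    also have "(\<Sum>j\<in>{..<K} - {i}. real (N' j) - real (N j)) \<le> (\<Sum>j\<in>{..<K} - {i}. W)"
      using le by (intro sum_mono) auto
    also have "\<dots> = real (card ({..<K} - {i})) * W" by simp
    also have "\<dots> \<le> K * W" using W i by (intro mult_right_mono) auto
    finally show False using KW by simp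
  qed
  then obtain j where j: "j < K" and Wj: "W < real (N' j) - real (N j)" by blast
  have ge1: "1 \<le> N i" "1 \<le> N' i" "1 \<le> N j" "1 \<le> N' j"
    using N(1) N'(1) i j by (auto simp: balanced_def)
  have ge2: "2 \<le> N i" "2 \<le> N' j" using Wi Wj W ge1 by linarith+
  have leT: "real (N k) \<le> T" "real (N' k) \<le> T" if "k < K" for k
    using that N(2) N'(2) member_le_sum[of k "{..<K}" N] member_le_sum[of k "{..<K}" N'] by auto
  have bW: "b * W = 4 * \<beta> * T + b" using b by (simp add: W_def field_simps)
  have sep: "(b + \<beta>) / sqrt (U - 1) < (b - \<beta>) / sqrt u"
    if "1 \<le> u" "W < U - u" "U \<le> T" for u U :: real
  proof -
    have "b * W < b * (U - u)" using that b by simp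
    hence "4 * \<beta> * T < b * (U - 1 - u)" using bW by (simp add: algebra_simps)
    thus ?thesis using that W b by (intro ucb_index_separation[of u "U - 1" "real T" b \<beta>]) auto
  qed
  have "(b + \<beta>) / sqrt (real (N i) - 1) < (b - \<beta>) / sqrt (N' i)"
    "(b + \<beta>) / sqrt (real (N' j) - 1) < (b - \<beta>) / sqrt (N j)"
    using Wi Wj ge1 leT i j by (auto intro!: sep)
  moreover have "\<mu> j + (b - \<beta>) / sqrt (N j) \<le> \<mu> i + (b + \<beta>) / sqrt (real (N i) - 1)"
    "\<mu> i + (b - \<beta>) / sqrt (N' i) \<le> \<mu> j + (b + \<beta>) / sqrt (real (N' j) - 1)"
    using N(1) N'(1) i j ge2 by (auto simp: balanced_def)
  ultimately show False by linarith
qed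

text \<open>Dropping the nonnegative bonus of \<open>j\<close> bounds the gap by
  \<open>2 * b / sqrt (N i - 1)\<close>; multiplying by \<open>N i - 1\<close> leaves a square root,
  bounded independently of the gap.\<close>

lemma balanced_gap:
  fixes T :: nat and b \<beta> :: real
  assumes N: "balanced K b \<beta> \<mu> N" "N i \<le> T" and b: "0 \<le> \<beta>" "\<beta> \<le> b" and ij: "i < K" "j < K"
  shows "(\<mu> j - \<mu> i) * (real (N i) - 1) \<le> 2 * b * sqrt T"
proof (cases "2 \<le> N i")
  case True
  define q where "q = sqrt (real (N i) - 1)"
  have q: "q > 0" "real (N i) - 1 = q * q" using True by (auto simp: q_def)
  have "1 \<le> N j" using N ij by (auto simp: balanced_def)
  hence "0 \<le> (b - \<beta>) / sqrt (N j)" using b by simp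
  moreover have "\<mu> j + (b - \<beta>) / sqrt (N j) \<le> \<mu> i + (b + \<beta>) / q"
    using N ij True by (auto simp: balanced_def q_def)
  ultimately have "\<mu> j - \<mu> i \<le> (b + \<beta>) / q" by simp
  also have "\<dots> \<le> 2 * b / q" using b q by (intro divide_right_mono) auto
  finally have "(\<mu> j - \<mu> i) * (q * q) \<le> 2 * b / q * (q * q)" using q by (intro mult_right_mono) auto
  also have "\<dots> = 2 * b * q" using q by simp
  also have "\<dots> \<le> 2 * b * sqrt T" using N(2) b by (intro mult_left_mono) (auto simp: q_def)
  finally show ?thesis using q by simp
next
  case False
  have "1 \<le> N i" using N ij by (auto simp: balanced_def)
  hence "N i = 1" using False by simp
  thus ?thesis using b by simp
qed

subsection \<open>Regret and variability of UCB\<close>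

lemma deviation_imp_mean_close:
  fixes S \<mu> \<beta> :: real and n :: nat
  assumes "\<bar>S - n * \<mu>\<bar> < \<beta> * sqrt n" "n \<ge> 1"
  shows "\<mu> - \<beta> / sqrt n \<le> S / n" "S / n \<le> \<mu> + \<beta> / sqrt n"
proof -
  have n: "real n > 0" "\<beta> * sqrt n = n * (\<beta> / sqrt n)" 
    using assms(2) by (auto simp: field_simps)
  have "\<bar>n * (S / n - \<mu>)\<bar> \<le> n * (\<beta> / sqrt n)"
    using assms n by (simp add: algebra_simps)
  hence "\<bar>S / n - \<mu>\<bar> \<le> \<beta> / sqrt n" using n(1) by (simp add: abs_mult del: times_divide_eq_right)
  thus "\<mu> - \<beta> / sqrt n \<le> S / n" "S / n \<le> \<mu> + \<beta> / sqrt n" by linarith+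
qed

text \<open>True means replace empirical ones in \<open>ucb_last_pull\<close> at the price of the
  confidence widths. As \<open>\<beta> \<le> b\<close>, the term
  \<open>(b - \<beta>) / sqrt n\<close> decreases in \<open>n\<close>, so the unknown count of
  \<open>j\<close> can be replaced by its final one.\<close>

lemma (in bandit_run) ucb_balanced:
  assumes \<pi>: "\<pi> = ucb K b" and K: "1 \<le> K" "K \<le> T" and b: "0 \<le> \<beta>" "\<beta> \<le> b"
    and x: "x \<in> concentrated \<beta> T" and as: "as \<in> set_pmf (actions \<pi> x T)"
  shows "balanced K b \<beta> (\<lambda>i. mean (\<nu> ! i)) (count_list as)"
  unfolding balanced_def
proof (intro conjI allI impI)
  note as' = as[unfolded \<pi>]
  show "1 \<le> count_list as i" if "i < K" for i
    by (rule ucb_pulls_every_arm[OF K(1) as' K(2) that])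
  fix i j assume i: "i < K" and j: "j < K" and N: "2 \<le> count_list as i"
  define m where "m = (\<lambda>k n. (\<Sum>s=1..n. x (k, s)) / real n)"
  have le: "count_list as k \<le> T" for k
    using actions_in_pull_lists as by (intro count_list_le_horizon) auto
  have close: "mean (\<nu> ! k) - \<beta> / sqrt n \<le> m k n" "m k n \<le> mean (\<nu> ! k) + \<beta> / sqrt n"
    if "k < K" "1 \<le> n" "n \<le> T" for k n
    using x that unfolding m_def
    by (intro deviation_imp_mean_close; simp add: concentrated_def)+
  obtain n where n: "1 \<le> n" "n \<le> count_list as j"
    "m j n + b / sqrt n \<le> m i (count_list as i - 1) + b / sqrt (count_list as i - 1)"
    using ucb_last_pull[OF K(1) as' N j] unfolding m_def by blast
  have "(b - \<beta>) / sqrt (count_list as j) \<le> (b - \<beta>) / sqrt n"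
    using n b by (intro divide_left_mono mult_pos_pos) auto
  also have "mean (\<nu> ! j) + \<dots> = mean (\<nu> ! j) - \<beta> / sqrt n + b / sqrt n"
    by (simp add: diff_divide_distrib)
  also have "\<dots> \<le> m j n + b / sqrt n" using close(1)[OF j, of n] n le[of j] by simp
  also note n(3)
  also have "m i (count_list as i - 1) \<le> mean (\<nu> ! i) + \<beta> / sqrt (count_list as i - 1)"
    using N le[of i] by (intro close(2) i) auto
  finally show "mean (\<nu> ! j) + (b - \<beta>) / sqrt (count_list as j) \<le>
      mean (\<nu> ! i) + (b + \<beta>) / sqrt (count_list as i - 1)"
    by (simp add: add_divide_distrib)
qed

definition failure_prob :: "nat \<Rightarrow> real \<Rightarrow> real \<Rightarrow> nat \<Rightarrow> real" where
  "failure_prob K \<sigma> \<beta> T = 2 * K * T * exp (- (\<beta>\<^sup>2 / (2 * \<sigma>\<^sup>2)))"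

lemma failure_prob_nonneg: "0 \<le> failure_prob K \<sigma> \<beta> T"
  by (simp add: failure_prob_def)

text \<open>The summand \<open>2 * M\<close> pays for the one pull left out in
  \<open>balanced_gap\<close>; on a bad table every pull is charged \<open>2 * M\<close>.\<close>

lemma ucb_regret_le:
  assumes \<nu>: "\<nu> \<in> sg_class M \<sigma> Kbar" and pos: "\<sigma> > 0" "\<beta> > 0" "\<beta> \<le> b" and T: "length \<nu> \<le> T"
    and alg: "alg T (length \<nu>) = ucb (length \<nu>) b"
  shows "regret alg \<nu> T \<le>
    length \<nu> * (2 * b * sqrt T + 2 * M + 2 * M * T * failure_prob (length \<nu>) \<sigma> \<beta> T)"
proof -
  have K: "1 \<le> length \<nu>" using sg_classD(1)[OF \<nu>] by simp
  interpret bandit_run \<nu> "ucb (length \<nu>) b"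
    by (rule bandit_run_sg_class[OF \<nu> is_policy_ucb[OF K]])
  have "0 < length \<nu>" using K by linarith
  from sg_classD(5)[OF \<nu> this] have M: "0 \<le> M" by simp
  have "gap \<nu> i * expected_pulls (ucb K b) \<nu> T i \<le>
      2 * b * sqrt T + 2 * M + 2 * M * T * failure_prob K \<sigma> \<beta> T" if i: "i < K" for i
  proof -
    have ne: "(\<lambda>j. mean (\<nu> ! j)) ` {..<K} \<noteq> {}" using i by auto
    hence "Max ((\<lambda>j. mean (\<nu> ! j)) ` {..<K}) \<in> (\<lambda>j. mean (\<nu> ! j)) ` {..<K}" by (intro Max_in) auto
    then obtain j where j: "j < K" "gap \<nu> i = mean (\<nu> ! j) - mean (\<nu> ! i)"
      unfolding gap_def by force
    have "gap \<nu> i * expected_pulls (ucb K b) \<nu> T i =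
        (\<integral>as. gap \<nu> i * count_list as i \<partial>action_law (ucb K b) \<nu> T)"
      by (simp add: expected_pulls_def)
    also have "\<dots> \<le> (2 * b * sqrt T + 2 * M) + (2 * M * T) * (2 * K * T * exp (- (\<beta>\<^sup>2 / (2 * \<sigma>\<^sup>2))))"
    proof (rule integral_action_law_le_concentrated[where T = T, OF sg_classD(6)[OF \<nu>] pos(1,2)])
      fix x as assume x: "x \<in> concentrated \<beta> T" and as: "as \<in> set_pmf (actions (ucb K b) x T)"
      have "balanced K b \<beta> (\<lambda>i. mean (\<nu> ! i)) (count_list as)"
        using K T pos by (intro ucb_balanced[OF refl _ _ _ _ x as]) auto
      moreover have "count_list as i \<le> T"
        using actions_in_pull_lists as by (intro count_list_le_horizon) auto
      ultimately have "gap \<nu> i * (real (count_list as i) - 1) \<le> 2 * b * sqrt T"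
        unfolding j(2) using pos i j(1) by (intro balanced_gap) auto
      thus "gap \<nu> i * count_list as i \<le> 2 * b * sqrt T + 2 * M"
        using gap_bounds[OF \<nu> i] by (simp add: algebra_simps)
    next
      fix as assume "as \<in> pull_lists K T"
      thus "gap \<nu> i * count_list as i \<le> 2 * M * T"
        using gap_bounds[OF \<nu> i] M count_list_le_horizon[of as K T i] by (intro mult_mono) auto
    qed (use pos M in auto)
    finally show ?thesis by (simp add: failure_prob_def)
  qed
  hence "(\<Sum>i<K. gap \<nu> i * expected_pulls (ucb K b) \<nu> T i) \<le>
      (\<Sum>i<K. 2 * b * sqrt T + 2 * M + 2 * M * T * failure_prob K \<sigma> \<beta> T)"
    by (intro sum_mono) auto
  thus ?thesis by (simp add: regret_def alg)
qed

text \<open>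
  The constant about which the second moment is taken is the pull count of an arbitrary run on a
  concentrated table.
\<close>

lemma ucb_variability_le:
  assumes \<nu>: "\<nu> \<in> sg_class M \<sigma> Kbar" and pos: "\<sigma> > 0" "\<beta> > 0" "\<beta> \<le> b" and T: "length \<nu> \<le> T"
    and alg: "alg T (length \<nu>) = ucb (length \<nu>) b"
  defines "D \<equiv> length \<nu> * (4 * \<beta> * T / b + 1)"
  shows "variability alg \<nu> T \<le> sqrt (D\<^sup>2 + (real T)\<^sup>2 * failure_prob (length \<nu>) \<sigma> \<beta> T)"
proof (rule variability_le)
  have K: "1 \<le> length \<nu>" using sg_classD(1)[OF \<nu>] by simp
  thus "0 < length \<nu>" by linarith
  interpret bandit_run \<nu> "ucb (length \<nu>) b"
    by (rule bandit_run_sg_class[OF \<nu> is_policy_ucb[OF K]])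
  fix i assume i: "i < K"
  have stable: "\<bar>real (count_list as i) - real (count_list bs i)\<bar> \<le> D"
    if "x \<in> concentrated \<beta> T" "as \<in> set_pmf (actions (ucb K b) x T)"
      "y \<in> concentrated \<beta> T" "bs \<in> set_pmf (actions (ucb K b) y T)" for x y as bs
  proof -
    have bal: "balanced K b \<beta> (\<lambda>i. mean (\<nu> ! i)) (count_list as)" "balanced K b \<beta> (\<lambda>i. mean (\<nu> ! i)) (count_list bs)"
      using K T pos by (auto intro!: ucb_balanced[OF refl _ _ _ _ that(1,2)] ucb_balanced[OF refl _ _ _ _ that(3,4)])
    have sums: "(\<Sum>i<K. count_list as i) = T" "(\<Sum>i<K. count_list bs i) = T"
      using actions_in_pull_lists that by (auto intro!: sum_count_list_pull_lists)
    have "real (count_list as i) - real (count_list bs i) \<le> D"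
      "real (count_list bs i) - real (count_list as i) \<le> D"
      unfolding D_def using pos
      by (auto intro!: balanced_stable[OF bal(1) sums(1) bal(2) sums(2) _ _ i]
          balanced_stable[OF bal(2) sums(2) bal(1) sums(1) _ _ i])
    thus ?thesis by simp
  qed
  have "\<exists>n\<le>T. \<forall>x as. x \<in> concentrated \<beta> T \<longrightarrow> as \<in> set_pmf (actions (ucb K b) x T) \<longrightarrow>
      \<bar>real (count_list as i) - real n\<bar> \<le> D"
  proof (cases "concentrated \<beta> T = {}")
    case False
    then obtain y where y: "y \<in> concentrated \<beta> T" by blast
    obtain bs where bs: "bs \<in> set_pmf (actions (ucb K b) y T)" using set_pmf_not_empty by fast
    have "count_list bs i \<le> T"
      using actions_in_pull_lists bs by (intro count_list_le_horizon) auto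
    thus ?thesis using stable[OF _ _ y bs] by blast
  qed auto
  then obtain n where n: "n \<le> T" and close: "\<And>x as. x \<in> concentrated \<beta> T \<Longrightarrow>
      as \<in> set_pmf (actions (ucb K b) x T) \<Longrightarrow> \<bar>real (count_list as i) - real n\<bar> \<le> D" by blast
  have "variance_pulls (ucb K b) \<nu> T i \<le> (\<integral>as. (real (count_list as i) - real n)\<^sup>2 \<partial>action_law (ucb K b) \<nu> T)"
    by (rule variance_pulls_le)
  also have "\<dots> \<le> D\<^sup>2 + (real T)\<^sup>2 * (2 * K * T * exp (- (\<beta>\<^sup>2 / (2 * \<sigma>\<^sup>2))))"
  proof (rule integral_action_law_le_concentrated[where T = T, OF sg_classD(6)[OF \<nu>] pos(1,2)])
    fix x as assume "x \<in> concentrated \<beta> T" "as \<in> set_pmf (actions (ucb K b) x T)"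
    from close[OF this] show "(real (count_list as i) - real n)\<^sup>2 \<le> D\<^sup>2"
      using power_mono[of "\<bar>real (count_list as i) - real n\<bar>" D 2] by simp
  next
    fix as assume "as \<in> pull_lists K T"
    hence "\<bar>real (count_list as i) - real n\<bar> \<le> real T"
      using count_list_le_horizon[of as K T i] n by auto
    from power_mono[OF this, of 2] show "(real (count_list as i) - real n)\<^sup>2 \<le> (real T)\<^sup>2" by simp
  qed auto
  finally show "sqrt (variance_pulls (alg T K) \<nu> T i) \<le>
      sqrt (D\<^sup>2 + (real T)\<^sup>2 * failure_prob K \<sigma> \<beta> T)"
    by (simp add: alg failure_prob_def)
qed

text \<open>With this width the tail is \<open>exp (- 9 / 2 * (ln T)^2) \<le> T powr (-3)\<close>,
  because \<open>ln T \<ge> 1\<close> for \<open>T \<ge> 3\<close>. This pays for the factor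
  \<open>T\<close> of the union bound and for the squared counts.\<close>

lemma failure_prob_log:
  assumes "\<sigma> > 0" "T \<ge> 3"
  shows "(real T)\<^sup>2 * failure_prob K \<sigma> (3 * \<sigma> * ln T) T \<le> 2 * K"
proof -
  have "exp 1 \<le> (3::real)" by (rule exp_le)
  hence "exp 1 \<le> real T" using assms(2) by linarith
  hence ln: "1 \<le> ln (real T)" using assms(2) by (subst ln_ge_iff) auto
  have "1 * ln (real T) \<le> ln T * ln T" using ln by (intro mult_right_mono) auto
  hence "- ((3 * \<sigma> * ln T)\<^sup>2 / (2 * \<sigma>\<^sup>2)) \<le> - (3 * ln (real T))"
    using assms ln by (simp add: power_mult_distrib power2_eq_square)
  hence "exp (- ((3 * \<sigma> * ln T)\<^sup>2 / (2 * \<sigma>\<^sup>2))) \<le> exp (- (3 * ln (real T)))" by simp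
  also have "\<dots> = 1 / (real T) ^ 3"
  proof -
    have "exp (3 * ln (real T)) = exp (ln (real T)) ^ 3" by (simp flip: exp_of_nat_mult)
    thus ?thesis using assms by (simp add: exp_minus inverse_eq_divide)
  qed
  finally have "2 * real K * real T * exp (- ((3 * \<sigma> * ln T)\<^sup>2 / (2 * \<sigma>\<^sup>2))) \<le>
      2 * real K * real T * (1 / (real T) ^ 3)"
    by (rule mult_left_mono) simp
  hence "(real T)\<^sup>2 * failure_prob K \<sigma> (3 * \<sigma> * ln T) T \<le> (real T)\<^sup>2 * (2 * real K * real T * (1 / (real T) ^ 3))"
    unfolding failure_prob_def by (rule mult_left_mono) simp
  also have "\<dots> = 2 * K" using assms(2) by (simp add: power2_eq_square power3_eq_cube)
  finally show ?thesis by simp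
qed

section \<open>UCB satisfies the standing assumptions; its worst-case bounds\<close>

definition ucb_algorithm :: "(nat \<Rightarrow> real) \<Rightarrow> algorithm" where
  "ucb_algorithm bonus T K = ucb K (bonus T)"

lemma is_algorithm_ucb: "is_algorithm (ucb_algorithm bonus)"
  by (simp add: is_algorithm_def ucb_algorithm_def is_policy_ucb)

lemma standing_assumptions_ucb: "standing_assumptions M \<sigma> Kbar (ucb_algorithm bonus)"
  unfolding standing_assumptions_def ucb_algorithm_def
proof (intro ballI allI impI conjI)
  fix \<nu> T i assume \<nu>: "\<nu> \<in> sg_class M \<sigma> Kbar" and i: "i < length \<nu>"
  have K: "1 \<le> length \<nu>" using sg_classD(1)[OF \<nu>] by simp
  interpret bandit_run \<nu> "ucb (length \<nu>) (bonus T)"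
    by (rule bandit_run_sg_class[OF \<nu> is_policy_ucb[OF K]])
  {
    fix j assume j: "j < length \<nu>" and eq: "\<nu> ! i = \<nu> ! j"
    \<comment> \<open>Swapping two arms of equal law leaves the instance unchanged.\<close>
    define \<tau> where "\<tau> = id(i := j, j := i)"
    have inv: "\<tau> (\<tau> k) = k" for k by (auto simp: \<tau>_def)
    have inj: "inj \<tau>" by (metis inv injI)
    have "\<tau> k \<in> {..<K}" if "k \<in> {..<K}" for k using that i j by (auto simp: \<tau>_def)
    hence img: "\<tau> ` {..<K} = {..<K}" using inv by (metis image_subsetI subsetI subset_antisym imageI)
    have "expected_pulls (ucb K (bonus T)) \<nu> T (\<tau> i) = expected_pulls (ucb K (bonus T)) \<nu> T i"
      by (rule expected_pulls_permute[OF inj img ucb_permute[OF inj img K]])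
        (use eq in \<open>auto simp: \<tau>_def\<close>)
    thus "expected_pulls (ucb K (bonus T)) \<nu> T i = expected_pulls (ucb K (bonus T)) \<nu> T j"
      by (simp add: \<tau>_def split: if_splits)
  next
    assume T: "K \<le> T"
    show "1 \<le> expected_pulls (ucb K (bonus T)) \<nu> T i"
      unfolding expected_pulls_def
      by (rule integral_action_law_bounds(1)[where b = "real T"])
        (use ucb_pulls_every_arm[OF K _ T i] count_list_le_horizon in auto)
  }
qed

lemma sg_class_nonempty:
  assumes "M > 0" "\<sigma> > 0" "Kbar \<ge> 2"
  shows "sg_class M \<sigma> Kbar \<noteq> {}"
  using two_point_bandit_in_class[of "1 / 2" \<sigma> M Kbar] assms by auto

lemma ucb_worst_case:
  assumes pos: "M > 0" "\<sigma> > 0" "Kbar \<ge> 2" and T: "T \<ge> 3" "T \<ge> Kbar"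
    and bonus: "3 * \<sigma> * ln T \<le> bonus T"
  shows "worst_regret M \<sigma> Kbar (ucb_algorithm bonus) T \<le> Kbar * (2 * bonus T * sqrt T + 2 * M + 4 * M * Kbar)"
    and "worst_variability M \<sigma> Kbar (ucb_algorithm bonus) T \<le> Kbar * (12 * \<sigma> * ln T * T / bonus T + 3)"
proof -
  have ln: "0 < ln (real T)" using T by simp
  have \<beta>: "0 < 3 * \<sigma> * ln T" using pos ln by simp
  hence b: "0 < bonus T" using bonus by linarith
  have fail: "(real T)\<^sup>2 * failure_prob (length \<nu>) \<sigma> (3 * \<sigma> * ln T) T \<le> 2 * length \<nu>" for \<nu> :: bandit
    using failure_prob_log[OF pos(2) T(1)] by simp
  show "worst_regret M \<sigma> Kbar (ucb_algorithm bonus) T \<le> Kbar * (2 * bonus T * sqrt T + 2 * M + 4 * M * Kbar)"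
    unfolding worst_regret_def
  proof (rule cSUP_least[OF sg_class_nonempty[OF pos]])
    fix \<nu> assume \<nu>: "\<nu> \<in> sg_class M \<sigma> Kbar"
    have K: "length \<nu> \<le> Kbar" by (rule sg_classD[OF \<nu>])
    have "real T * failure_prob (length \<nu>) \<sigma> (3 * \<sigma> * ln T) T
        \<le> (real T)\<^sup>2 * failure_prob (length \<nu>) \<sigma> (3 * \<sigma> * ln T) T"
      using T by (intro mult_right_mono failure_prob_nonneg) (auto simp: power2_eq_square)
    also have "\<dots> \<le> 2 * Kbar" using fail[of \<nu>] K by simp
    finally have f: "2 * M * (real T * failure_prob (length \<nu>) \<sigma> (3 * \<sigma> * ln T) T) \<le> 2 * M * (2 * Kbar)"
      using pos by (intro mult_left_mono) auto
    have "regret (ucb_algorithm bonus) \<nu> T \<le> length \<nu> *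
        (2 * bonus T * sqrt T + 2 * M + 2 * M * T * failure_prob (length \<nu>) \<sigma> (3 * \<sigma> * ln T) T)"
      using K T by (intro ucb_regret_le[OF \<nu> pos(2) \<beta> bonus]) (auto simp: ucb_algorithm_def)
    also have "\<dots> \<le> Kbar * (2 * bonus T * sqrt T + 2 * M + 4 * M * Kbar)"
      using K f pos b failure_prob_nonneg by (intro mult_mono) auto
    finally show "regret (ucb_algorithm bonus) \<nu> T \<le> Kbar * (2 * bonus T * sqrt T + 2 * M + 4 * M * Kbar)" .
  qed
  show "worst_variability M \<sigma> Kbar (ucb_algorithm bonus) T \<le> Kbar * (12 * \<sigma> * ln T * T / bonus T + 3)"
    unfolding worst_variability_def
  proof (rule cSUP_least[OF sg_class_nonempty[OF pos]])
    fix \<nu> assume \<nu>: "\<nu> \<in> sg_class M \<sigma> Kbar"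
    have K: "length \<nu> \<le> Kbar" "1 \<le> length \<nu>" using sg_classD(1,2)[OF \<nu>] by auto
    define q where "q = 4 * (3 * \<sigma> * ln T) * T / bonus T + 1"
    have q: "q \<ge> 0" using \<beta> b by (simp add: q_def)
    have "variability (ucb_algorithm bonus) \<nu> T \<le>
        sqrt ((length \<nu> * q)\<^sup>2 + (real T)\<^sup>2 * failure_prob (length \<nu>) \<sigma> (3 * \<sigma> * ln T) T)"
      unfolding q_def using K T
      by (intro ucb_variability_le[OF \<nu> pos(2) \<beta> bonus]) (auto simp: ucb_algorithm_def)
    also have "\<dots> \<le> length \<nu> * q + 2 * length \<nu>"
    proof (rule real_le_lsqrt)
      \<comment> \<open>The failure term \<open>2 * K\<close> is at most \<open>(2 * K)^2\<close>,
        so it fits into the square of a sum with nonnegative cross term.\<close>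
      have "1 * real (length \<nu>) \<le> real (length \<nu>) * real (length \<nu>)" using K(2) by (intro mult_right_mono) auto
      hence "2 * real (length \<nu>) \<le> (2 * length \<nu>)\<^sup>2" by (simp add: power2_eq_square)
      moreover have "(length \<nu> * q)\<^sup>2 + (2 * length \<nu>)\<^sup>2 \<le> (length \<nu> * q + 2 * length \<nu>)\<^sup>2"
        using q by (simp add: power2_sum)
      ultimately show "(length \<nu> * q)\<^sup>2 + (real T)\<^sup>2 * failure_prob (length \<nu>) \<sigma> (3 * \<sigma> * ln T) T
          \<le> (length \<nu> * q + 2 * length \<nu>)\<^sup>2"
        using fail[of \<nu>] by linarith
    qed (use q in auto)
    also have "\<dots> = length \<nu> * (q + 2)" by (simp add: algebra_simps)
    also have "\<dots> \<le> Kbar * (q + 2)" using K q by (intro mult_right_mono) auto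
    finally show "variability (ucb_algorithm bonus) \<nu> T \<le> Kbar * (12 * \<sigma> * ln T * T / bonus T + 3)"
      by (simp add: q_def algebra_simps)
  qed
qed

subsection \<open>The frontier\<close>

text \<open>If a product is of order \<open>T powr (3/2)\<close> and one factor is at most linear,
  the other is at least of order \<open>sqrt T\<close>. This absorbs the lower-order terms of the
  UCB bounds.\<close>

lemma frontier_point_bounds:
  fixes r s :: "nat \<Rightarrow> real"
  assumes nonneg: "\<And>T. r T \<ge> 0" "\<And>T. s T \<ge> 0"
    and rs: "(\<lambda>T. r T * s T) \<in> \<Theta>(\<lambda>T. real T powr (3/2))"
    and O: "r \<in> O(\<lambda>T. real T)" "s \<in> O(\<lambda>T. real T)"
  obtains c C :: real where "c > 0" "C > 0"
    and "\<forall>\<^sub>F T in sequentially. c * T powr (3/2) \<le> r T * s T \<and> r T * s T \<le> C * T powr (3/2) \<and>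
      r T \<le> C * T \<and> sqrt T \<le> C * r T \<and> sqrt T \<le> C * s T \<and> 0 < r T \<and> 0 < s T"
proof -
  obtain C1 where C1: "C1 > 0" "\<forall>\<^sub>F T in sequentially. norm (r T * s T) \<le> C1 * norm (real T powr (3/2))"
    using landau_o.bigE[OF bigthetaD1[OF rs]] by blast
  obtain c where c: "c > 0" "\<forall>\<^sub>F T in sequentially. norm (r T * s T) \<ge> c * norm (real T powr (3/2))"
    using landau_omega.bigE[OF bigthetaD2[OF rs]] by blast
  obtain C2 where C2: "C2 > 0" "\<forall>\<^sub>F T in sequentially. norm (r T) \<le> C2 * norm (real T)"
    using landau_o.bigE[OF O(1)] by blast
  obtain C3 where C3: "C3 > 0" "\<forall>\<^sub>F T in sequentially. norm (s T) \<le> C3 * norm (real T)"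
    using landau_o.bigE[OF O(2)] by blast
  define C where "C = C1 + C2 + C2 / c + C3 / c"
  have C: "C > 0" "C1 \<le> C" "C2 \<le> C" "C2 / c \<le> C" "C3 / c \<le> C" using C1 C2 C3 c by (auto simp: C_def add_pos_pos)
  have "\<forall>\<^sub>F T in sequentially. c * T powr (3/2) \<le> r T * s T \<and> r T * s T \<le> C * T powr (3/2) \<and>
      r T \<le> C * T \<and> sqrt T \<le> C * r T \<and> sqrt T \<le> C * s T \<and> 0 < r T \<and> 0 < s T"
    using C1(2) c(2) C2(2) C3(2) eventually_gt_at_top[of 0]
  proof eventually_elim
    case (elim T)
    have T: "real T > 0" using elim by simp
    have eq: "real T powr (3/2) = T * sqrt T"
      using T powr_add[of "real T" 1 "1/2"] by (simp add: powr_half_sqrt)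
    have lo: "c * (T * sqrt T) \<le> r T * s T" and hi: "r T * s T \<le> C1 * (T * sqrt T)"
      and r: "r T \<le> C2 * T" and s: "s T \<le> C3 * T"
      using elim nonneg by (simp_all add: eq abs_mult)
    have "0 < c * (T * sqrt T)" using T c by simp
    hence "0 < r T * s T" using lo by linarith
    hence pos: "0 < r T" "0 < s T" using nonneg[of T] by (auto simp: zero_less_mult_iff)
    have hiC: "C1 * (T * sqrt T) \<le> C * (T * sqrt T)" using C T by (intro mult_right_mono) auto
    have rC: "C2 * T \<le> C * T" using C T by (intro mult_right_mono) auto
    have "r T * s T \<le> r T * (C3 * T)" using s pos by (intro mult_left_mono) auto
    hence "c * (T * sqrt T) \<le> r T * (C3 * T)" using lo by linarith
    hence "c * sqrt T \<le> C3 * r T" using T by (simp add: mult_ac)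
    hence "sqrt T \<le> C3 / c * r T" using c by (simp add: field_simps)
    also have "\<dots> \<le> C * r T" using C pos by (intro mult_right_mono) auto
    finally have sr: "sqrt T \<le> C * r T" .
    have "r T * s T \<le> (C2 * T) * s T" using r pos by (intro mult_right_mono) auto
    hence "c * (T * sqrt T) \<le> (C2 * T) * s T" using lo by linarith
    hence "c * sqrt T \<le> C2 * s T" using T by (simp add: mult_ac)
    hence "sqrt T \<le> C2 / c * s T" using c by (simp add: field_simps)
    also have "\<dots> \<le> C * s T" using C pos by (intro mult_right_mono) auto
    finally have ss: "sqrt T \<le> C * s T" .
    show ?case using lo hi hiC r rC sr ss pos by (simp add: eq)
  qed
  thus ?thesis by (rule that[OF c(1) C(1)])
qed

text \<open>The first summand keeps the bonus above the confidence width. In the second, the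
  division by \<open>ln T\<close> makes the regret sublinear even for \<open>r\<close> of order
  \<open>T\<close>.\<close>

definition frontier_bonus :: "real \<Rightarrow> (nat \<Rightarrow> real) \<Rightarrow> nat \<Rightarrow> real" where
  "frontier_bonus \<sigma> r T = 3 * \<sigma> * ln T + r T / (sqrt T * ln T)"

text \<open>The first regret bound is \<open>o(T)\<close> and yields active learning; the second
  regret bound and the variability bound place the algorithm at the point
  \<open>(r, s)\<close>.\<close>

lemma ucb_frontier_bounds:
  fixes r s :: "nat \<Rightarrow> real" and c C :: real
  assumes pos: "M > 0" "\<sigma> > 0" "Kbar \<ge> 2" and C: "c > 0" "C > 0"
    and ev: "\<forall>\<^sub>F T in sequentially. c * T powr (3/2) \<le> r T * s T \<and> r T * s T \<le> C * T powr (3/2) \<and>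
      r T \<le> C * T \<and> sqrt T \<le> C * r T \<and> sqrt T \<le> C * s T \<and> 0 < r T \<and> 0 < s T"
  defines "alg \<equiv> ucb_algorithm (frontier_bonus \<sigma> r)"
  obtains D :: real where "D > 0"
    and "\<forall>\<^sub>F T in sequentially. worst_regret M \<sigma> Kbar alg T \<le> D * (sqrt T * ln T + T / ln T)"
    and "\<forall>\<^sub>F T in sequentially. worst_regret M \<sigma> Kbar alg T \<le> D * (r T * ln T ^ 2)"
    and "\<forall>\<^sub>F T in sequentially. worst_variability M \<sigma> Kbar alg T \<le> D * (s T * ln T ^ 2)"
proof -
  define E where "E = 2 * M + 4 * M * Kbar"
  \<comment> \<open>Sums the coefficients of all three estimates, so that one constant serves
    them.\<close>
  define D where "D = Kbar * (6 * \<sigma> + 6 * \<sigma> * C + 2 + 2 * C + E + E * C + 12 * \<sigma> / c + 3 * C)"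
  have E: "E > 0" using pos by (simp add: E_def add_pos_nonneg)
  have D: "D > 0" unfolding D_def using pos C E by (intro mult_pos_pos add_pos_pos divide_pos_pos) auto
  have "\<forall>\<^sub>F T in sequentially.
      worst_regret M \<sigma> Kbar alg T \<le> D * (sqrt T * ln T + T / ln T) \<and>
      worst_regret M \<sigma> Kbar alg T \<le> D * (r T * ln T ^ 2) \<and>
      worst_variability M \<sigma> Kbar alg T \<le> D * (s T * ln T ^ 2)"
    using ev eventually_ge_at_top[of "max 3 Kbar"]
  proof eventually_elim
    case (elim T)
    hence T: "T \<ge> 3" "T \<ge> Kbar" by auto
    define l where "l = ln (real T)"
    have "exp 1 \<le> real T" using T exp_le by linarith
    hence l: "1 \<le> l" unfolding l_def using T by (subst ln_ge_iff) auto
    have q: "0 < sqrt T" "sqrt T * sqrt T = T" "1 \<le> sqrt T" using T by auto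
    define b where "b = frontier_bonus \<sigma> r T"
    have rT: "0 < r T" "0 < s T" using elim by auto
    have b1: "3 * \<sigma> * ln T \<le> frontier_bonus \<sigma> r T"
      using rT l q by (simp add: frontier_bonus_def l_def)
    have bq: "b * sqrt T = 3 * \<sigma> * (sqrt T * l) + r T / l"
      using q l by (simp add: b_def frontier_bonus_def l_def[symmetric] field_simps)
    have "2 * b * sqrt T + 2 * M + 4 * M * Kbar = 6 * \<sigma> * (sqrt T * l) + 2 * (r T / l) + E"
      unfolding mult.assoc[of 2 b] bq by (simp add: E_def)
    hence WR: "worst_regret M \<sigma> Kbar alg T \<le> Kbar * (6 * \<sigma> * (sqrt T * l) + 2 * (r T / l) + E)"
      using ucb_worst_case(1)[where T = T and bonus = "frontier_bonus \<sigma> r", OF pos T b1]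
      by (simp only: alg_def b_def)
    have ll: "1 \<le> l * l" "l \<le> l * l" "1 / l \<le> 1" using l mult_mono[of 1 l 1 l] mult_right_mono[of 1 l l] by auto
    have first: "worst_regret M \<sigma> Kbar alg T \<le> D * (sqrt T * l + T / l)"
    proof -
      define X where "X = sqrt T * l + T / l"
      have "r T / l \<le> C * T / l" using elim l by (intro divide_right_mono) auto
      moreover have "0 \<le> T / l" "1 \<le> sqrt T * l" using l q mult_mono[of 1 "sqrt T" 1 l] by auto
      hence X: "sqrt T * l \<le> X" "T / l \<le> X" "1 \<le> X" by (auto simp: X_def)
      moreover have "C * (T / l) \<le> C * X" using C X by (intro mult_left_mono) auto
      moreover have "6 * \<sigma> * (sqrt T * l) \<le> 6 * \<sigma> * X" using X pos by (intro mult_left_mono) auto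
      moreover have "E * 1 \<le> E * X" using E X by (intro mult_left_mono) auto
      ultimately have "6 * \<sigma> * (sqrt T * l) + 2 * (r T / l) + E \<le> 6 * \<sigma> * X + 2 * (C * X) + E * X"
        by simp
      also have "\<dots> = (6 * \<sigma> + 2 * C + E) * X" by (simp add: algebra_simps)
      also have "\<dots> \<le> (6 * \<sigma> + 6 * \<sigma> * C + 2 + 2 * C + E + E * C + 12 * \<sigma> / c + 3 * C) * X"
        using X pos C E by (intro mult_right_mono) auto
      finally have "Kbar * (6 * \<sigma> * (sqrt T * l) + 2 * (r T / l) + E) \<le> D * X"
        unfolding D_def mult.assoc by (intro mult_left_mono) auto
      thus ?thesis using WR by (simp add: X_def)
    qed
    have second: "worst_regret M \<sigma> Kbar alg T \<le> D * (r T * l ^ 2)"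
    proof -
      define X where "X = r T * l ^ 2"
      have rX: "r T \<le> X" "r T * l \<le> X" using rT ll mult_left_mono[of 1 "l * l" "r T"] mult_left_mono[of l "l * l" "r T"]
        by (auto simp: X_def power2_eq_square)
      have "sqrt T * l \<le> C * r T * l" using elim l by (intro mult_right_mono) auto
      also have "\<dots> \<le> C * X" using rX C by (simp add: mult.assoc)
      finally have 1: "6 * \<sigma> * (sqrt T * l) \<le> 6 * \<sigma> * (C * X)" using pos by (intro mult_left_mono) auto
      have 2: "r T / l \<le> X" using rX l rT by (simp add: field_simps) (smt (verit) mult_left_mono mult_cancel_left1 mult_less_cancel_left2)
      have "1 \<le> C * r T" using elim q by linarith
      also have "\<dots> \<le> C * X" using rX C by simp
      finally have 3: "E * 1 \<le> E * (C * X)" using E by (intro mult_left_mono) auto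
      have "6 * \<sigma> * (sqrt T * l) + 2 * (r T / l) + E \<le> 6 * \<sigma> * (C * X) + 2 * X + E * (C * X)"
        using 1 2 3 by simp
      also have "\<dots> = (6 * \<sigma> * C + 2 + E * C) * X" by (simp add: algebra_simps)
      also have "\<dots> \<le> (6 * \<sigma> + 6 * \<sigma> * C + 2 + 2 * C + E + E * C + 12 * \<sigma> / c + 3 * C) * X"
        using rX rT pos C E by (intro mult_right_mono) auto
      finally have "Kbar * (6 * \<sigma> * (sqrt T * l) + 2 * (r T / l) + E) \<le> D * X"
        unfolding D_def mult.assoc by (intro mult_left_mono) auto
      thus ?thesis using WR by (simp add: X_def)
    qed
    have third: "worst_variability M \<sigma> Kbar alg T \<le> D * (s T * l ^ 2)"
    proof -
      define X where "X = s T * l ^ 2"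
      have sX: "s T \<le> X" using rT ll mult_left_mono[of 1 "l * l" "s T"]
        by (auto simp: X_def power2_eq_square)
      have eq: "real T powr (3/2) = T * sqrt T"
        using T powr_add[of "real T" 1 "1/2"] by (simp add: powr_half_sqrt)
      have rl: "0 < r T / (sqrt T * l)" "r T / (sqrt T * l) \<le> b"
        using rT q l pos by (auto simp: b_def frontier_bonus_def l_def[symmetric])
      \<comment> \<open>The summand \<open>r / (sqrt T * l)\<close> of the bonus suffices here, and
        \<open>T powr (3/2) / r \<le> s / c\<close> since the point lies on the curve.\<close>
      have "\<sigma> * l * T / b \<le> \<sigma> * l * T / (r T / (sqrt T * l))"
        using rl l pos by (intro divide_left_mono mult_pos_pos) auto
      also have "\<dots> = \<sigma> * l^2 * (T * sqrt T) / r T" by (simp add: power2_eq_square)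
      also have "\<dots> \<le> \<sigma> * l^2 * (r T * s T / c) / r T"
        using elim C l pos rT by (intro divide_right_mono mult_left_mono) (auto simp: eq field_simps)
      also have "\<dots> = \<sigma> / c * X" using rT by (simp add: X_def)
      finally have 1: "12 * (\<sigma> * l * T / b) \<le> 12 * (\<sigma> / c * X)" by simp
      have "1 \<le> C * s T" using elim q by linarith
      also have "\<dots> \<le> C * X" using sX C by simp
      finally have 2: "3 \<le> 3 * (C * X)" by simp
      have "12 * \<sigma> * l * T / b + 3 \<le> (12 * \<sigma> / c + 3 * C) * X"
        using 1 2 by (simp add: algebra_simps)
      also have "\<dots> \<le> (6 * \<sigma> + 6 * \<sigma> * C + 2 + 2 * C + E + E * C + 12 * \<sigma> / c + 3 * C) * X"
        using sX rT pos C E by (intro mult_right_mono) auto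
      finally have "Kbar * (12 * \<sigma> * l * T / b + 3) \<le> D * X"
        unfolding D_def mult.assoc by (intro mult_left_mono) auto
      thus ?thesis using ucb_worst_case(2)[where T = T and bonus = "frontier_bonus \<sigma> r", OF pos T b1] by (simp add: X_def alg_def b_def l_def)
    qed
    show ?case using first second third by (simp add: l_def)
  qed
  thus ?thesis using that D by (auto simp: eventually_conj_iff)
qed

lemma worst_nonneg:
  assumes pos: "M > 0" "\<sigma> > 0" "Kbar \<ge> 2" and alg: "is_algorithm alg"
  shows "0 \<le> worst_regret M \<sigma> Kbar alg T" "0 \<le> worst_variability M \<sigma> Kbar alg T"
proof -
  obtain \<nu> where \<nu>: "\<nu> \<in> sg_class M \<sigma> Kbar" using sg_class_nonempty[OF pos] by blast
  show "0 \<le> worst_regret M \<sigma> Kbar alg T"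
    using regret_bounds(1)[OF alg \<nu>] regret_le_worst_regret[OF alg \<nu>] by (rule order_trans)
  show "0 \<le> worst_variability M \<sigma> Kbar alg T"
    using variability_bounds(1)[OF alg \<nu>] variability_le_worst_variability[OF alg \<nu>] by (rule order_trans)
qed

lemma frontier_point_achievable:
  fixes r s :: "nat \<Rightarrow> real"
  assumes pos: "M > 0" "\<sigma> > 0" "Kbar \<ge> 2"
    and nonneg: "\<And>T. r T \<ge> 0" "\<And>T. s T \<ge> 0"
    and rs: "(\<lambda>T. r T * s T) \<in> \<Theta>(\<lambda>T. real T powr (3/2))"
    and O: "r \<in> O(\<lambda>T. real T)" "s \<in> O(\<lambda>T. real T)"
  shows "\<exists>alg. active_learning M \<sigma> Kbar alg \<and>
           worst_regret M \<sigma> Kbar alg \<in> O(\<lambda>T. r T * ln (real T) ^ 2) \<and>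
           r \<in> O(\<lambda>T. worst_regret M \<sigma> Kbar alg T * ln (real T) ^ 2) \<and>
           worst_variability M \<sigma> Kbar alg \<in> O(\<lambda>T. s T * ln (real T) ^ 2) \<and>
           s \<in> O(\<lambda>T. worst_variability M \<sigma> Kbar alg T * ln (real T) ^ 2)"
proof -
  obtain c C :: real where cC: "c > 0" "C > 0"
    and ev: "\<forall>\<^sub>F T in sequentially. c * T powr (3/2) \<le> r T * s T \<and> r T * s T \<le> C * T powr (3/2) \<and>
      r T \<le> C * T \<and> sqrt T \<le> C * r T \<and> sqrt T \<le> C * s T \<and> 0 < r T \<and> 0 < s T"
    by (rule frontier_point_bounds[OF nonneg rs O])
  define alg where "alg = ucb_algorithm (frontier_bonus \<sigma> r)"
  define WR where "WR = worst_regret M \<sigma> Kbar alg"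
  define WS where "WS = worst_variability M \<sigma> Kbar alg"
  obtain D where D: "D > 0"
    and WR1: "\<forall>\<^sub>F T in sequentially. WR T \<le> D * (sqrt T * ln T + T / ln T)"
    and WR2: "\<forall>\<^sub>F T in sequentially. WR T \<le> D * (r T * ln T ^ 2)"
    and WS: "\<forall>\<^sub>F T in sequentially. WS T \<le> D * (s T * ln T ^ 2)"
    using ucb_frontier_bounds[OF pos cC ev] unfolding WR_def WS_def alg_def by blast
  have isalg: "is_algorithm alg" unfolding alg_def by (rule is_algorithm_ucb)
  have nn: "0 \<le> WR T" "0 \<le> WS T" for T
    unfolding WR_def WS_def using worst_nonneg[OF pos isalg] by auto
  have "(\<lambda>T. WR T / real T) \<longlonglongrightarrow> 0"
  proof (rule tendsto_sandwich[of "\<lambda>_. 0"])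
    show "(\<lambda>T. D * (sqrt (real T) * ln T + T / ln T) / real T) \<longlonglongrightarrow> 0" by real_asymp
    show "\<forall>\<^sub>F T in sequentially. WR T / real T \<le> D * (sqrt T * ln T + T / ln T) / real T"
      using WR1 by eventually_elim (auto intro: divide_right_mono)
  qed (use nn in auto)
  hence al: "active_learning M \<sigma> Kbar alg"
    using isalg standing_assumptions_ucb unfolding active_learning_def WR_def alg_def by blast
  have lower: "\<forall>\<^sub>F T in sequentially. \<sigma> / 32 * real T powr (3/2) \<le> WR T * WS T"
    unfolding WR_def WS_def by (rule active_learning_lower_bound[OF pos al])
  define B where "B = C * (32 / \<sigma>) * D"
  \<comment> \<open>The point lies on the curve and the algorithm cannot lie below it. An upper
    bound on one coordinate of the algorithm therefore becomes a lower bound on the other, after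
    cancelling \<open>s\<close> or \<open>r\<close>.\<close>
  have rs_le: "\<forall>\<^sub>F T in sequentially. r T * s T \<le> C * (32 / \<sigma>) * (WR T * WS T)"
    using ev lower
  proof eventually_elim
    case (elim T)
    have "T powr (3/2) \<le> 32 / \<sigma> * (WR T * WS T)" using elim pos by (simp add: field_simps)
    hence "C * T powr (3/2) \<le> C * (32 / \<sigma> * (WR T * WS T))" using cC by (intro mult_left_mono) auto
    thus ?case using elim by (simp add: mult.assoc)
  qed
  have C': "0 \<le> C * (32 / \<sigma>)" using cC pos by simp
  have "WR \<in> O(\<lambda>T. r T * ln (real T) ^ 2)"
    by (rule bigoI[of _ D]) (use WR2 in \<open>eventually_elim, use nn nonneg in \<open>simp add: abs_mult\<close>\<close>)
  moreover have "WS \<in> O(\<lambda>T. s T * ln (real T) ^ 2)"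
    by (rule bigoI[of _ D]) (use WS in \<open>eventually_elim, use nn nonneg in \<open>simp add: abs_mult\<close>\<close>)
  moreover have "r \<in> O(\<lambda>T. WR T * ln (real T) ^ 2)"
  proof (rule bigoI[of _ B])
    show "\<forall>\<^sub>F T in sequentially. norm (r T) \<le> B * norm (WR T * ln (real T) ^ 2)"
      using ev rs_le WS
    proof eventually_elim
      case (elim T)
      have "C * (32 / \<sigma>) * (WR T * WS T) \<le> C * (32 / \<sigma>) * (WR T * (D * (s T * ln T ^ 2)))"
        using elim nn C' by (intro mult_left_mono) auto
      hence "r T * s T \<le> (B * (WR T * ln T ^ 2)) * s T" using elim by (simp add: B_def mult_ac)
      hence "r T \<le> B * (WR T * ln T ^ 2)" using elim by (simp add: mult_le_cancel_right_pos)
      thus ?case using nn nonneg by (simp add: abs_mult)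
    qed
  qed
  moreover have "s \<in> O(\<lambda>T. WS T * ln (real T) ^ 2)"
  proof (rule bigoI[of _ B])
    show "\<forall>\<^sub>F T in sequentially. norm (s T) \<le> B * norm (WS T * ln (real T) ^ 2)"
      using ev rs_le WR2
    proof eventually_elim
      case (elim T)
      have "C * (32 / \<sigma>) * (WR T * WS T) \<le> C * (32 / \<sigma>) * ((D * (r T * ln T ^ 2)) * WS T)"
        using elim nn C' by (intro mult_left_mono mult_right_mono) auto
      hence "s T * r T \<le> (B * (WS T * ln T ^ 2)) * r T" using elim by (simp add: B_def mult_ac)
      hence "s T \<le> B * (WS T * ln T ^ 2)" using elim by (simp add: mult_le_cancel_right_pos)
      thus ?case using nn nonneg by (simp add: abs_mult)
    qed
  qed
  ultimately show ?thesis using al unfolding WR_def WS_def by blast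
qed

text \<open>Achievability is stated in both directions, so that the algorithm sits at the prescribed
  point up to logarithms and not merely below it. Points are restricted to linear growth because
  regret and variability never exceed a multiple of \<open>T\<close>.\<close>

theorem corollary4:
  fixes M \<sigma> :: real and Kbar :: nat
  assumes "M > 0" and "\<sigma> > 0" and "Kbar \<ge> 2"
  shows
    "(\<exists>c>0. \<forall>alg. active_learning M \<sigma> Kbar alg \<longrightarrow>
        (\<forall>\<^sub>F T in sequentially.
           worst_regret M \<sigma> Kbar alg T * worst_variability M \<sigma> Kbar alg T
             \<ge> c * real T powr (3/2))) \<and>
     (\<exists>k::nat. \<forall>r s :: nat \<Rightarrow> real.
        (\<forall>T. r T \<ge> 0) \<and> (\<forall>T. s T \<ge> 0) \<and>
        (\<lambda>T. r T * s T) \<in> \<Theta>(\<lambda>T. real T powr (3/2)) \<and>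
        r \<in> O(\<lambda>T. real T) \<and> s \<in> O(\<lambda>T. real T) \<longrightarrow>
        (\<exists>alg. active_learning M \<sigma> Kbar alg \<and>
           worst_regret M \<sigma> Kbar alg \<in> O(\<lambda>T. r T * ln (real T) ^ k) \<and>
           r \<in> O(\<lambda>T. worst_regret M \<sigma> Kbar alg T * ln (real T) ^ k) \<and>
           worst_variability M \<sigma> Kbar alg \<in> O(\<lambda>T. s T * ln (real T) ^ k) \<and>
           s \<in> O(\<lambda>T. worst_variability M \<sigma> Kbar alg T * ln (real T) ^ k)))"
proof (intro conjI)
  show "\<exists>c>0. \<forall>alg. active_learning M \<sigma> Kbar alg \<longrightarrow>
        (\<forall>\<^sub>F T in sequentially.
           worst_regret M \<sigma> Kbar alg T * worst_variability M \<sigma> Kbar alg T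
             \<ge> c * real T powr (3/2))"
    using active_learning_lower_bound[OF assms] assms(2) by (intro exI[of _ "\<sigma> / 32"]) auto
  show "\<exists>k::nat. \<forall>r s :: nat \<Rightarrow> real.
        (\<forall>T. r T \<ge> 0) \<and> (\<forall>T. s T \<ge> 0) \<and>
        (\<lambda>T. r T * s T) \<in> \<Theta>(\<lambda>T. real T powr (3/2)) \<and>
        r \<in> O(\<lambda>T. real T) \<and> s \<in> O(\<lambda>T. real T) \<longrightarrow>
        (\<exists>alg. active_learning M \<sigma> Kbar alg \<and>
           worst_regret M \<sigma> Kbar alg \<in> O(\<lambda>T. r T * ln (real T) ^ k) \<and>
           r \<in> O(\<lambda>T. worst_regret M \<sigma> Kbar alg T * ln (real T) ^ k) \<and>
           worst_variability M \<sigma> Kbar alg \<in> O(\<lambda>T. s T * ln (real T) ^ k) \<and>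
           s \<in> O(\<lambda>T. worst_variability M \<sigma> Kbar alg T * ln (real T) ^ k))"
    \<comment> \<open>In the variability bound one logarithm comes from the width of the confidence
      intervals and one from the division by \<open>ln T\<close> in the bonus.\<close>
    by (rule exI[of _ 2], intro allI impI, elim conjE,
        rule frontier_point_achievable[OF assms]) auto
qed

end
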